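(* Let $P$ be a Markov counting process with jump intensity $\ell$ (satisfying the standing assumptions below), and let $\Xi_\ell$ be its reciprocal characteristic. If $$\inf_{t\in[0,1],\,z\in\mathbb{N}}\Xi_\ell(t,z)\ge 0,$$ then for all $0\le s\le u\le 1$ and all $x\le y$ in $\mathbb{N}$, the function $[s,u]\ni t\mapsto E_{P^{xy}_{su}}(X_t)$ is convex. Conversely, if $$\sup_{t\in[0,1],\,z\in\mathbb{N}}\Xi_\ell(t,z)\le 0,$$ then for all $0\le s\le u\le 1$ and all $x\le y$ in $\mathbb{N}$, the function $[s,u]\ni t\mapsto E_{P^{xy}_{su}}(X_t)$ is concave.
   Context: $\Omega$ is the space of càdlàg step functions $\omega:[0,1]\to\mathbb{N}$ with finitely many jumps, all of amplitude $+1$, with no jump at $t=0$ or $t=1$; $X=(X_t)_{t\in[0,1]}$ is the canonical process. A Markov counting process with intensity $\ell:[0,1]\times\mathbb{N}\to\mathbb{R}_+$ is a probability $P$ on $\Omega$ under which $t\mapsto X_t-X_0-\int_0^t\ell(r,X_{r^-})\,dr$ is a local martingale. Standing assumptions: (i) for every $z$, $t\mapsto\ell(t,z)$ is continuously differentiable on $[0,1]$; (ii) $(t,z)\mapsto \ell(t,z+1)-\ell(t,z)$ is globally bounded above and below; (iii) $\ell(t,z)>0$ for all $t,z$; and the initial law of $P$ has full support on $\mathbb{N}$. For $s\le u$ and $x\le y$, the bridge is $P^{xy}_{su}(\cdot)=P(\cdot\mid X_s=x,X_u=y)$, and $E_{P^{xy}_{su}}$ denotes expectation under it. The reciprocal characteristic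 is $\Xi_\ell(t,z)=\partial_t\log\ell(t,z)+\ell(t,z+1)-\ell(t,z)$ if $\ell(t,z)\neq0$, and $\Xi_\ell(t,z)=0$ if $\ell(t,z)=0$. *)

theory Defs
  imports "HOL-Probability.Probability"
begin

text \<open>Paths are functions real => nat; only the values on [0,1] matter; we normalise paths
to be 0 outside [0,1]. A path is a cadlag step function with finitely many jumps of
amplitude +1, none at 0 or 1: X_t = X_0 + number of jump times r in J with r <= t.\<close>

definition Omega :: "(real \<Rightarrow> nat) set" where
  "Omega = {\<omega>. (\<exists>J. finite J \<and> J \<subseteq> {0<..<1} \<and>
                  (\<forall>t\<in>{0..1}. \<omega> t = \<omega> 0 + card {r\<in>J. r \<le> t})) \<and>
               (\<forall>t. t \<notin> {0..1} \<longrightarrow> \<omega> t = 0)}"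

definition gen_sets :: "real set \<Rightarrow> (real \<Rightarrow> nat) set set" where
  "gen_sets T = {{\<omega>\<in>Omega. \<omega> r = n} | r n. r \<in> T}"

definition filt :: "real \<Rightarrow> (real \<Rightarrow> nat) measure" where
  "filt t = sigma Omega (gen_sets {0..t})"

definition canonical :: "(real \<Rightarrow> nat) measure" where
  "canonical = sigma Omega (gen_sets {0..1})"

definition martingale_on :: "(real \<Rightarrow> nat) measure \<Rightarrow> (real \<Rightarrow> (real \<Rightarrow> nat) \<Rightarrow> real) \<Rightarrow> bool" where
  "martingale_on P M \<longleftrightarrow>
     (\<forall>t\<in>{0..1}. M t \<in> borel_measurable (filt t) \<and> integrable P (M t)) \<and>
     (\<forall>s t. 0 \<le> s \<longrightarrow> s \<le> t \<longrightarrow> t \<le> 1 \<longrightarrow>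
        (AE \<omega> in P. real_cond_exp P (filt s) (M t) \<omega> = M s \<omega>))"

definition local_martingale_on :: "(real \<Rightarrow> nat) measure \<Rightarrow> (real \<Rightarrow> (real \<Rightarrow> nat) \<Rightarrow> real) \<Rightarrow> bool" where
  "local_martingale_on P M \<longleftrightarrow>
     (\<exists>\<tau> :: nat \<Rightarrow> (real \<Rightarrow> nat) \<Rightarrow> real.
        (\<forall>n. stopping_time filt (\<tau> n)) \<and>
        (\<forall>n \<omega>. 0 \<le> \<tau> n \<omega> \<and> \<tau> n \<omega> \<le> \<tau> (Suc n) \<omega>) \<and>
        (AE \<omega> in P. \<exists>n. 1 \<le> \<tau> n \<omega>) \<and>
        (\<forall>n. martingale_on P (\<lambda>t \<omega>. M (min t (\<tau> n \<omega>)) \<omega>)))"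

definition left_lim :: "(real \<Rightarrow> nat) \<Rightarrow> real \<Rightarrow> nat" where
  "left_lim \<omega> r = Lim (at_left r) \<omega>"

definition compensated :: "(real \<Rightarrow> nat \<Rightarrow> real) \<Rightarrow> real \<Rightarrow> (real \<Rightarrow> nat) \<Rightarrow> real" where
  "compensated l t \<omega> = real (\<omega> t) - real (\<omega> 0) - (LBINT r=0..t. l r (left_lim \<omega> r))"

definition markov_counting_process :: "(real \<Rightarrow> nat) measure \<Rightarrow> (real \<Rightarrow> nat \<Rightarrow> real) \<Rightarrow> bool" where
  "markov_counting_process P l \<longleftrightarrow>
     prob_space P \<and> sets P = sets canonical \<and> local_martingale_on P (compensated l)"

definition bridge :: "(real \<Rightarrow> nat) measure \<Rightarrow> real \<Rightarrow> real \<Rightarrow> nat \<Rightarrow> nat \<Rightarrow> (real \<Rightarrow> nat) measure" where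
  "bridge P s u x y = uniform_measure P {\<omega>\<in>space P. \<omega> s = x \<and> \<omega> u = y}"

definition bridge_exp :: "(real \<Rightarrow> nat) measure \<Rightarrow> real \<Rightarrow> real \<Rightarrow> nat \<Rightarrow> nat \<Rightarrow> real \<Rightarrow> real" where
  "bridge_exp P s u x y t = integral\<^sup>L (bridge P s u x y) (\<lambda>\<omega>. real (\<omega> t))"

definition Xi :: "(real \<Rightarrow> nat \<Rightarrow> real) \<Rightarrow> real \<Rightarrow> nat \<Rightarrow> real" where
  "Xi l t z = (if l t z \<noteq> 0
      then vector_derivative (\<lambda>r. ln (l r z)) (at t within {0..1}) + l t (z + 1) - l t z
      else 0)"

end

theory Submission
  imports Defs
begin

text \<open>
  Riemann sums of the integral of the indicator of \<open>X = z\<close> against the compensated process show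
  that the indicator of \<open>X\<^sub>t \<le> z\<close>, plus the integral of \<open>l(r, z)\<close> over the time \<open>r \<le> t\<close> spent in
  \<open>z\<close>, is a martingale. Hence, for every event \<open>A\<close> of the past of \<open>s\<close>, the functions
  \<open>p(t, z) = P(A, X\<^sub>t = z)\<close> solve the forward equation \<open>p' = l(z - 1) p(z - 1) - l(z) p(z)\<close> after \<open>s\<close>.
  Let \<open>h\<close> solve the backward equation \<open>h' = - l(z) (h(z + 1) - h(z))\<close> with \<open>h(u, z) = 1\<close> if \<open>z = y\<close>
  and \<open>0\<close> otherwise. Then the sum of \<open>p h\<close> over \<open>z\<close> does not depend on \<open>t\<close>, which is the Markov property
  \<open>P(A, X\<^sub>u = y) = \<Sum> P(A, X\<^sub>t = z) h(t, z)\<close>. Consequently, up to normalisation, the bridge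
  expectation is \<open>\<Sum> z p(z) h(z)\<close>, its derivative is \<open>\<Sum> p(z) l(z) h(z + 1)\<close> and its second
  derivative is \<open>\<Sum> p(z) l(z) h(z + 1) \<Xi>(z)\<close>.
\<close>

subsection \<open>Paths\<close>

lemma path_jumps:
  assumes "\<omega> \<in> Omega"
  shows "\<exists>J. finite J \<and> J \<subseteq> {0<..<1} \<and>
    (\<forall>a b. 0 \<le> a \<longrightarrow> a \<le> b \<longrightarrow> b \<le> 1 \<longrightarrow> \<omega> b = \<omega> a + card {r\<in>J. a < r \<and> r \<le> b})"
proof -
  obtain J where J: "finite J" "J \<subseteq> {0<..<1}" "\<forall>t\<in>{0..1}. \<omega> t = \<omega> 0 + card {r\<in>J. r \<le> t}"
    using assms by (auto simp: Omega_def)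
  have "\<omega> b = \<omega> a + card {r\<in>J. a < r \<and> r \<le> b}" if "0 \<le> a" "a \<le> b" "b \<le> 1" for a b
  proof -
    have "{r\<in>J. r \<le> b} = {r\<in>J. r \<le> a} \<union> {r\<in>J. a < r \<and> r \<le> b}"
      using that by auto
    then have "card {r\<in>J. r \<le> b} = card {r\<in>J. r \<le> a} + card {r\<in>J. a < r \<and> r \<le> b}"
      using J(1) by (simp add: card_Un_disjoint disjoint_iff)
    moreover have "\<omega> a = \<omega> 0 + card {r\<in>J. r \<le> a}"
      by (rule J(3)[rule_format]) (use that in auto)
    moreover have "\<omega> b = \<omega> 0 + card {r\<in>J. r \<le> b}"
      by (rule J(3)[rule_format]) (use that in auto)
    ultimately show ?thesis by linarith
  qed
  with J(1,2) show ?thesis by blast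
qed

lemma path_mono:
  assumes "\<omega> \<in> Omega" "0 \<le> a" "a \<le> b" "b \<le> 1"
  shows "\<omega> a \<le> \<omega> b"
proof -
  obtain J where "finite J" "J \<subseteq> {0<..<1}" and
    J: "\<And>a b. 0 \<le> a \<Longrightarrow> a \<le> b \<Longrightarrow> b \<le> 1 \<Longrightarrow> \<omega> b = \<omega> a + card {r\<in>J. a < r \<and> r \<le> b}"
    using path_jumps[OF assms(1)] by blast
  from J[OF assms(2-4)] show ?thesis by linarith
qed

text \<open>A path keeps its value from \<open>a\<close> up to its next jump, so some rational time
  in between sees the same value. This turns conditions over a continuum of times into countable
  unions in the measurability proofs below.\<close>

lemma path_right_cont:
  assumes "\<omega> \<in> Omega" "0 \<le> a" "a < b" "b \<le> 1"
  obtains q where "q \<in> \<rat>" "a < q" "q < b" "\<omega> q = \<omega> a"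
proof -
  obtain J where J: "finite J" "J \<subseteq> {0<..<1}"
    "\<And>a b. 0 \<le> a \<Longrightarrow> a \<le> b \<Longrightarrow> b \<le> 1 \<Longrightarrow> \<omega> b = \<omega> a + card {r\<in>J. a < r \<and> r \<le> b}"
    using path_jumps[OF assms(1)] by blast
  define c where "c = Min (insert b {r\<in>J. a < r})"
  have c: "a < c" "c \<le> b" "\<And>r. r \<in> J \<Longrightarrow> a < r \<Longrightarrow> c \<le> r"
    using J(1) assms(3) by (auto simp: c_def)
  obtain q where q: "q \<in> \<rat>" "a < q" "q < c"
    using Rats_dense_in_real c(1) by blast
  have "{r\<in>J. a < r \<and> r \<le> q} = {}"
    using c(3) q(3) by force
  then have "card {r\<in>J. a < r \<and> r \<le> q} = 0" by (simp only: card.empty)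
  then have "\<omega> q = \<omega> a"
    using J(3)[of a q] q c assms by simp
  with q c that show ?thesis by auto
qed

text \<open>Distinct jump times are at least \<open>Min D\<close> apart, so a shorter interval
  contains at most one of them. Fine partitions therefore see at most one jump per cell.\<close>

lemma path_small_increments:
  assumes "\<omega> \<in> Omega"
  obtains \<delta> where "\<delta> > 0"
    "\<And>a b. 0 \<le> a \<Longrightarrow> a \<le> b \<Longrightarrow> b \<le> 1 \<Longrightarrow> b - a < \<delta> \<Longrightarrow> \<omega> b \<le> Suc (\<omega> a)"
proof -
  obtain J where J: "finite J" "J \<subseteq> {0<..<1}"
    "\<And>a b. 0 \<le> a \<Longrightarrow> a \<le> b \<Longrightarrow> b \<le> 1 \<Longrightarrow> \<omega> b = \<omega> a + card {r\<in>J. a < r \<and> r \<le> b}"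
    using path_jumps[OF assms(1)] by blast
  \<comment> \<open>The element 1 keeps \<open>D\<close> nonempty when there are fewer than two
    jumps.\<close>
  define D where "D = insert 1 ((\<lambda>(a, b). \<bar>a - b\<bar>) ` {(a, b). a \<in> J \<and> b \<in> J \<and> a \<noteq> b})"
  have "finite {(a, b). a \<in> J \<and> b \<in> J \<and> a \<noteq> b}"
    by (rule finite_subset[of _ "J \<times> J"]) (use J(1) in auto)
  then have fin: "finite D"
    by (simp add: D_def)
  have pos: "Min D > 0"
    using fin by (auto simp: D_def)
  have "\<omega> b \<le> Suc (\<omega> a)" if ab: "0 \<le> a" "a \<le> b" "b \<le> 1" "b - a < Min D" for a b
  proof -
    have "card {r\<in>J. a < r \<and> r \<le> b} \<le> Suc 0"
    proof (subst card_le_Suc0_iff_eq)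
      show "finite {r\<in>J. a < r \<and> r \<le> b}" using J(1) by simp
      show "\<forall>p\<in>{r\<in>J. a < r \<and> r \<le> b}. \<forall>q\<in>{r\<in>J. a < r \<and> r \<le> b}. p = q"
      proof (intro ballI, rule ccontr)
        fix p q assume pq: "p \<in> {r\<in>J. a < r \<and> r \<le> b}" "q \<in> {r\<in>J. a < r \<and> r \<le> b}" "p \<noteq> q"
        then have "\<bar>p - q\<bar> \<in> D" by (auto simp: D_def image_iff)
        then have "Min D \<le> \<bar>p - q\<bar>" using fin by simp
        with pq ab show False by auto
      qed
    qed
    with J(3)[OF ab(1-3)] show ?thesis by simp
  qed
  with pos that show ?thesis by blast
qed

text \<open>The exceptional set is finite, hence negligible for the integral in the compensator,
  which can then be written with the path itself.\<close>

lemma left_lim_eq: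
  assumes "\<omega> \<in> Omega"
  obtains J where "finite J" "\<And>r. r \<in> {0..1} \<Longrightarrow> r \<notin> J \<Longrightarrow> left_lim \<omega> r = \<omega> r"
proof -
  obtain J where J: "finite J" "J \<subseteq> {0<..<1}"
    "\<And>a b. 0 \<le> a \<Longrightarrow> a \<le> b \<Longrightarrow> b \<le> 1 \<Longrightarrow> \<omega> b = \<omega> a + card {r\<in>J. a < r \<and> r \<le> b}"
    using path_jumps[OF assms(1)] by blast
  \<comment> \<open>Time 0 is excepted as well: paths vanish to the left of 0, so the left limit
    there is 0 whatever \<open>\<omega> 0\<close> is.\<close>
  have "left_lim \<omega> r = \<omega> r" if r: "r \<in> {0..1}" "r \<notin> insert 0 J" for r
  proof -
    define c where "c = Max (insert 0 {p\<in>J. p < r})"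
    have c: "0 \<le> c" "c < r" "\<And>p. p \<in> J \<Longrightarrow> p < r \<Longrightarrow> p \<le> c"
      using J(1) r by (auto simp: c_def)
    have "\<omega> q = \<omega> r" if "c < q" "q < r" for q
    proof -
      have "{p\<in>J. q < p \<and> p \<le> r} = {}"
        using c(3) r(2) that by (force simp: less_le)
      then have "card {p\<in>J. q < p \<and> p \<le> r} = 0" by (simp only: card.empty)
      then show ?thesis using J(3)[of q r] that c r by simp
    qed
    then have "eventually (\<lambda>q. \<omega> r = \<omega> q) (at_left r)"
      unfolding eventually_at_left_field using c(2) by metis
    then have "(\<omega> \<longlongrightarrow> \<omega> r) (at_left r)"
      by (rule Lim_transform_eventually[OF tendsto_const])
    then show ?thesis
      unfolding left_lim_def by (intro tendsto_Lim) simp_all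
  qed
  with J(1) that[of "insert 0 J"] show ?thesis by auto
qed

section \<open>The canonical filtration and measurability of evaluations\<close>

lemma gen_sets_subset: "gen_sets T \<subseteq> Pow Omega"
  by (auto simp: gen_sets_def)

lemma space_filt [simp]: "space (filt t) = Omega"
  by (simp add: filt_def gen_sets_subset)

lemma space_canonical [simp]: "space canonical = Omega"
  by (simp add: canonical_def gen_sets_subset)

lemma filt_eval: "0 \<le> r \<Longrightarrow> r \<le> t \<Longrightarrow> {\<omega>\<in>Omega. \<omega> r = n} \<in> sets (filt t)"
  by (auto simp: filt_def gen_sets_subset gen_sets_def)

lemma gen_sets_mono: "S \<subseteq> T \<Longrightarrow> gen_sets S \<subseteq> gen_sets T"
  by (auto simp: gen_sets_def)

lemma filt_mono: "s \<le> t \<Longrightarrow> sets (filt s) \<subseteq> sets (filt t)"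
  by (simp add: filt_def gen_sets_subset sigma_sets_mono' gen_sets_mono)

lemma filt_subset_canonical: "t \<le> 1 \<Longrightarrow> sets (filt t) \<subseteq> sets canonical"
  by (simp add: filt_def canonical_def gen_sets_subset sigma_sets_mono' gen_sets_mono)

lemma measurable_eval: "0 \<le> r \<Longrightarrow> r \<le> 1 \<Longrightarrow> (\<lambda>\<omega>. \<omega> r) \<in> measurable canonical (count_space UNIV)"
  using filt_eval[of r 1] filt_subset_canonical[of 1]
  by (auto simp: measurable_count_space_eq2_countable vimage_def Int_def conj_commute)

lemma eval_le_sets: "0 \<le> r \<Longrightarrow> r \<le> 1 \<Longrightarrow> {\<omega>\<in>Omega. \<omega> r \<le> k} \<in> sets canonical"
  using measurable_sets[OF measurable_eval[of r], of "{..k}"]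
  by (simp add: vimage_def Int_def conj_commute)

text \<open>Functions of time are controlled on [0,1] only. Composition with this continuous
  projection makes them continuous or Borel on the whole line and leaves them unchanged on
  [0,1].\<close>

definition clamp01 :: "real \<Rightarrow> real" where "clamp01 r = max 0 (min 1 r)"

lemma clamp01 [simp]: "0 \<le> clamp01 r" "clamp01 r \<le> 1" "r \<in> {0..1} \<Longrightarrow> clamp01 r = r"
  by (auto simp: clamp01_def)

lemma continuous_clamp01 [continuous_intros]: "continuous_on S clamp01"
  unfolding clamp01_def by (intro continuous_intros)

lemma measurable_clamp01 [measurable]: "clamp01 \<in> borel_measurable borel"
  by (intro borel_measurable_continuous_onI continuous_clamp01)

text \<open>Sublevel sets are the convenient events for monotone paths. A single level is a
  difference of two consecutive sublevel sets, and there are only countably many levels.\<close>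

lemma measurable_nat_le:
  fixes f :: "'a \<Rightarrow> nat"
  assumes "\<And>k. {x\<in>space M. f x \<le> k} \<in> sets M"
  shows "f \<in> measurable M (count_space UNIV)"
proof -
  have "{x\<in>space M. f x = k} \<in> sets M" for k
  proof (cases k)
    case 0
    then show ?thesis using assms[of 0] by simp
  next
    case (Suc j)
    have "{x\<in>space M. f x = k} = {x\<in>space M. f x \<le> k} - {x\<in>space M. f x \<le> j}"
      using Suc by auto
    then show ?thesis using assms by simp
  qed
  then show ?thesis
    by (auto simp: measurable_count_space_eq2_countable vimage_def Int_def conj_commute)
qed

text \<open>By monotonicity and right continuity, a path is at most \<open>k\<close> at a time
  before 1 iff it is at most \<open>k\<close> at some later rational time. The event is thus a
  countable union of rectangles.\<close>

lemma measurable_eval_pair: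
  "(\<lambda>(r, \<omega>). \<omega> (clamp01 r)) \<in> measurable (borel \<Otimes>\<^sub>M canonical) (count_space UNIV)"
proof (rule measurable_nat_le)
  fix k
  \<comment> \<open>The first set takes care of times above 1, which no \<open>q\<close> in the
    union dominates.\<close>
  have "{x\<in>space (borel \<Otimes>\<^sub>M canonical). (case x of (r, \<omega>) \<Rightarrow> \<omega> (clamp01 r)) \<le> k}
      = UNIV \<times> {\<omega>\<in>Omega. \<omega> 1 \<le> k} \<union> (\<Union>q\<in>\<rat>\<inter>{0..1}. {..q} \<times> {\<omega>\<in>Omega. \<omega> q \<le> k})" (is "?L = ?R")
  proof (intro set_eqI iffI)
    fix x assume x: "x \<in> ?L"
    obtain r \<omega> where [simp]: "x = (r, \<omega>)" by (cases x)
    have w: "\<omega> \<in> Omega" "\<omega> (clamp01 r) \<le> k"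
      using x by (auto simp: space_pair_measure)
    show "x \<in> ?R"
    proof (cases "clamp01 r = 1")
      case False
      then have "clamp01 r < 1" using clamp01(2)[of r] by linarith
      then obtain q where "q \<in> \<rat>" "clamp01 r < q" "q < 1" "\<omega> q = \<omega> (clamp01 r)"
        using path_right_cont[OF w(1), of "clamp01 r" 1] by auto
      moreover have "r \<le> q"
        using calculation by (auto simp: clamp01_def)
      moreover have "0 \<le> q"
        using calculation clamp01(1)[of r] by linarith
      ultimately show ?thesis using w by auto
    qed (use w in auto)
  next
    fix x assume x: "x \<in> ?R"
    obtain r \<omega> where [simp]: "x = (r, \<omega>)" by (cases x)
    have "\<omega> \<in> Omega" "\<exists>q. 0 \<le> q \<and> q \<le> 1 \<and> clamp01 r \<le> q \<and> \<omega> q \<le> k"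
      using x by (auto simp: clamp01_def intro: exI[of _ "1::real"])
    then obtain q where q: "0 \<le> q" "q \<le> 1" "clamp01 r \<le> q" "\<omega> q \<le> k" "\<omega> \<in> Omega"
      by auto
    then have "\<omega> (clamp01 r) \<le> k"
      using path_mono[of \<omega> "clamp01 r" q] by auto
    with q show "x \<in> ?L" by (auto simp: space_pair_measure)
  qed
  also have "\<dots> \<in> sets (borel \<Otimes>\<^sub>M canonical)"
    by (intro sets.Un sets.countable_UN'' pair_measureI eval_le_sets) (auto intro: countable_rat countable_Int1)
  finally show "{x\<in>space (borel \<Otimes>\<^sub>M canonical). (case x of (r, \<omega>) \<Rightarrow> \<omega> (clamp01 r)) \<le> k}
      \<in> sets (borel \<Otimes>\<^sub>M canonical)" .
qed

lemma measurable_path_clamp: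
  assumes "\<omega> \<in> Omega"
  shows "(\<lambda>r. \<omega> (clamp01 r)) \<in> measurable borel (count_space UNIV)"
proof -
  have "(\<lambda>r. (r, \<omega>)) \<in> measurable borel (borel \<Otimes>\<^sub>M canonical)"
    using assms by (intro measurable_Pair) auto
  from measurable_compose[OF this measurable_eval_pair] show ?thesis by simp
qed

text \<open>The argument for joint measurability applies with the condition on time replaced by the
  event \<open>\<tau> \<omega> \<le> q\<close>, which is measurable because \<open>\<tau>\<close> is
  a stopping time.\<close>

lemma measurable_stopped_eval:
  assumes "stopping_time filt \<tau>" "\<And>\<omega>. 0 \<le> \<tau> \<omega>" "0 \<le> t" "t \<le> 1"
  shows "(\<lambda>\<omega>. \<omega> (min t (\<tau> \<omega>))) \<in> measurable canonical (count_space UNIV)"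
proof (rule measurable_nat_le)
  fix k
  have st: "{\<omega>\<in>Omega. \<tau> \<omega> \<le> q} \<in> sets canonical" if "q \<le> 1" for q
    using assms(1) filt_subset_canonical[OF that] by (auto simp: stopping_time_def pred_def)
  have "{\<omega>\<in>space canonical. \<omega> (min t (\<tau> \<omega>)) \<le> k}
     = {\<omega>\<in>Omega. \<omega> t \<le> k} \<union> (\<Union>q\<in>\<rat>\<inter>{0..t}. {\<omega>\<in>Omega. \<tau> \<omega> \<le> q} \<inter> {\<omega>\<in>Omega. \<omega> q \<le> k})" (is "?L = ?R")
  proof (intro set_eqI iffI)
    fix \<omega> assume x: "\<omega> \<in> ?L"
    show "\<omega> \<in> ?R"
    proof (cases "t \<le> \<tau> \<omega>")
      case False
      then obtain q where "q \<in> \<rat>" "\<tau> \<omega> < q" "q < t" "\<omega> q = \<omega> (\<tau> \<omega>)"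
        using path_right_cont[of \<omega> "\<tau> \<omega>" t] x assms by auto
      moreover have "0 \<le> q" using calculation assms(2)[of \<omega>] by linarith
      ultimately show ?thesis using x False by (intro UnI2 UN_I[of q]) auto
    qed (use x in auto)
  next
    fix \<omega> assume x: "\<omega> \<in> ?R"
    then obtain q where q: "0 \<le> q" "q \<le> t" "min t (\<tau> \<omega>) \<le> q" "\<omega> q \<le> k" "\<omega> \<in> Omega"
      using assms by auto
    then have "\<omega> (min t (\<tau> \<omega>)) \<le> \<omega> q"
      using path_mono[of \<omega> "min t (\<tau> \<omega>)" q] assms by auto
    with q show "\<omega> \<in> ?L" by auto
  qed
  also have "\<dots> \<in> sets canonical"
    using assms by (intro sets.Un sets.countable_UN'' sets.Int eval_le_sets st) (auto intro: countable_rat countable_Int1)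
  finally show "{\<omega>\<in>space canonical. \<omega> (min t (\<tau> \<omega>)) \<le> k} \<in> sets canonical" .
qed

subsection \<open>Compensators along a path\<close>

text \<open>Compactness of [0,1] bounds each level, and only finitely many levels enter. For a
  single path, \<open>k = \<omega> 1\<close> covers every level visited.\<close>

lemma path_bounded:
  fixes f :: "real \<Rightarrow> nat \<Rightarrow> real"
  assumes "\<And>w. continuous_on {0..1} (\<lambda>r. f r w)"
  obtains B where "0 \<le> B" "\<And>r w. r \<in> {0..1} \<Longrightarrow> w \<le> k \<Longrightarrow> \<bar>f r w\<bar> \<le> B"
proof -
  have "bounded (\<Union>w\<le>k. (\<lambda>r. f r w) ` {0..1})"
    by (intro bounded_UN) (auto intro!: compact_imp_bounded compact_continuous_image assms)
  then obtain B where B: "\<And>x. x \<in> (\<Union>w\<le>k. (\<lambda>r. f r w) ` {0..1}) \<Longrightarrow> norm x \<le> B"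
    unfolding bounded_iff by blast
  show ?thesis
    by (rule that[of "max 0 B"]) (use B in \<open>force simp: le_max_iff_disj\<close>)+
qed

text \<open>The path stays below \<open>\<omega> 1\<close>, so the integrand is bounded.
  Measurability follows, after clamping time, from a countable case split over the level.\<close>

lemma path_set_integrable:
  fixes f :: "real \<Rightarrow> nat \<Rightarrow> real"
  assumes "\<And>w. continuous_on {0..1} (\<lambda>r. f r w)" and \<omega>: "\<omega> \<in> Omega"
  shows "set_integrable lborel {0..1} (\<lambda>r. f r (\<omega> r))"
proof -
  obtain B where B: "0 \<le> B" "\<And>r w. r \<in> {0..1} \<Longrightarrow> w \<le> \<omega> 1 \<Longrightarrow> \<bar>f r w\<bar> \<le> B"
    using path_bounded[of f, OF assms(1)] by metis
  have m: "(\<lambda>r. f (clamp01 r) w) \<in> borel_measurable borel" for w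
    by (intro borel_measurable_continuous_onI continuous_on_compose2[OF assms(1)] continuous_clamp01) auto
  have "(\<lambda>r. f (clamp01 r) (\<omega> (clamp01 r))) \<in> borel_measurable borel"
    using measurable_compose_countable[OF m measurable_path_clamp[OF \<omega>]] .
  then have "(\<lambda>r. indicator {0..1} r *\<^sub>R f (clamp01 r) (\<omega> (clamp01 r))) \<in> borel_measurable lborel"
    by simp
  moreover have "(\<lambda>r. indicator {0..1} r *\<^sub>R f (clamp01 r) (\<omega> (clamp01 r))) = (\<lambda>r. indicator {0..1} r *\<^sub>R f r (\<omega> r))"
    by (auto simp: indicator_def)
  ultimately show ?thesis
    unfolding set_integrable_def
    by (intro integrableI_bounded_set[where A="{0..1}" and B=B])
       (auto simp: B path_mono[OF \<omega>])
qed

lemma path_integrable_on: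
  fixes f :: "real \<Rightarrow> nat \<Rightarrow> real"
  assumes "\<And>w. continuous_on {0..1} (\<lambda>r. f r w)" and \<omega>: "\<omega> \<in> Omega" and "0 \<le> a" "b \<le> 1"
  shows "(\<lambda>r. f r (\<omega> r)) integrable_on {a..b}"
  using set_borel_integral_eq_integral(1)[OF path_set_integrable[of f, OF assms(1,2)]] assms(3,4)
  by (auto intro: integrable_subinterval_real)

lemma integral_from_0_diff:
  fixes g :: "real \<Rightarrow> real"
  assumes "g integrable_on {0..1}" "0 \<le> a" "a \<le> b" "b \<le> 1"
  shows "integral {0..b} g - integral {0..a} g = integral {a..b} g"
  using Henstock_Kurzweil_Integration.integral_combine[of 0 a b g] integrable_subinterval_real[OF assms(1), of 0 b] assms
  by auto

section \<open>Path integrals of the intensity and the level process\<close>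

locale intensity =
  fixes l :: "real \<Rightarrow> nat \<Rightarrow> real"
  assumes cont: "\<And>z. continuous_on {0..1} (\<lambda>r. l r z)"
    and lip: "\<exists>c. \<forall>t\<in>{0..1}. \<forall>z. \<bar>l t (z + 1) - l t z\<bar> \<le> c"
    and nonneg: "\<And>t z. t \<in> {0..1} \<Longrightarrow> 0 \<le> l t z"
begin

text \<open>Compactness bounds level 0, and each further level adds at most the increment bound.
  This keeps the compensator over a short interval a small multiple of one plus the path.\<close>

lemma linear_growth:
  obtains C where "0 < C" "\<And>t z. t \<in> {0..1} \<Longrightarrow> l t z \<le> C * (1 + real z)"
proof -
  obtain c where c: "\<And>t z. t \<in> {0..1} \<Longrightarrow> \<bar>l t (z + 1) - l t z\<bar> \<le> c"
    using lip by blast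
  obtain B where B: "0 \<le> B" "\<And>r w. r \<in> {0..1} \<Longrightarrow> w \<le> 0 \<Longrightarrow> \<bar>l r w\<bar> \<le> B"
    using path_bounded[of l 0, OF cont] by metis
  \<comment> \<open>This dominates both the bound at level 0 and the increments; the summand 1 makes
    it strictly positive.\<close>
  define C where "C = B + \<bar>c\<bar> + 1"
  have "l t z \<le> C * (1 + real z)" if "t \<in> {0..1}" for t z
  proof (induction z)
    case 0
    show ?case using B(2)[OF that, of 0] by (simp add: C_def)
  next
    case (Suc z)
    have "C * (1 + real (Suc z)) = C * (1 + real z) + C" by (simp add: algebra_simps)
    then show ?case using Suc c[OF that, of z] B(1) by (simp add: C_def)
  qed
  moreover have "C > 0" using B(1) by (simp add: C_def)
  ultimately show ?thesis using that by blast
qed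

abbreviation rate :: "(real \<Rightarrow> nat) \<Rightarrow> real \<Rightarrow> real" where
  "rate \<omega> r \<equiv> l r (\<omega> r)"

abbreviation rate_at :: "nat \<Rightarrow> (real \<Rightarrow> nat) \<Rightarrow> real \<Rightarrow> real" where
  "rate_at z \<omega> r \<equiv> (if \<omega> r = z then l r (\<omega> r) else 0)"

lemma rate_integrable: "\<omega> \<in> Omega \<Longrightarrow> 0 \<le> a \<Longrightarrow> b \<le> 1 \<Longrightarrow> rate \<omega> integrable_on {a..b}"
  by (rule path_integrable_on[of l, OF cont])

lemma cont_at_level: "continuous_on {0..1} (\<lambda>r. if w = z then l r w else 0)"
  by (cases "w = z") (simp_all add: cont)

lemma rate_at_integrable: "\<omega> \<in> Omega \<Longrightarrow> 0 \<le> a \<Longrightarrow> b \<le> 1 \<Longrightarrow> rate_at z \<omega> integrable_on {a..b}"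
  by (rule path_integrable_on[of "\<lambda>r w. if w = z then l r w else 0", OF cont_at_level])

text \<open>Two technicalities of the definition disappear here: left limits differ from values at
  finitely many times only, and the Lebesgue integral agrees with the gauge integral used from here
  on.\<close>

lemma compensated_eq:
  assumes \<omega>: "\<omega> \<in> Omega" and t: "0 \<le> t" "t \<le> 1"
  shows "compensated l t \<omega> = real (\<omega> t) - real (\<omega> 0) - integral {0..t} (rate \<omega>)"
proof -
  obtain J where J: "finite J" "\<And>r. r \<in> {0..1} \<Longrightarrow> r \<notin> J \<Longrightarrow> left_lim \<omega> r = \<omega> r"
    using left_lim_eq[OF \<omega>] by blast
  have "(LBINT r=0..t. l r (left_lim \<omega> r)) = (LINT r:{0..t}|lborel. l r (left_lim \<omega> r))"
    using interval_integral_Icc[of 0 t] t by (simp add: zero_ereal_def)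
  also have "\<dots> = (LINT r:{0..t}|lborel. rate \<omega> r)"
    unfolding set_lebesgue_integral_def
    by (rule integral_discrete_difference[where X=J])
       (use J t in \<open>auto simp: indicator_def countable_finite\<close>)
  also have "\<dots> = integral {0..t} (rate \<omega>)"
    by (intro set_borel_integral_eq_integral(2) set_integrable_subset[OF path_set_integrable[of l, OF cont \<omega>]])
       (use t in auto)
  finally show ?thesis by (simp add: compensated_def)
qed

lemma rate_integral_bound:
  assumes C: "\<And>t z. t \<in> {0..1} \<Longrightarrow> l t z \<le> C * (1 + real z)" "0 < C"
    and \<omega>: "\<omega> \<in> Omega" and ab: "0 \<le> a" "a \<le> b" "b \<le> 1"
  shows "integral {a..b} (rate \<omega>) \<le> C * (1 + real (\<omega> b)) * (b - a)"
proof -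
  have "rate \<omega> r \<le> C * (1 + real (\<omega> b))" if "r \<in> {a..b}" for r
  proof -
    have "rate \<omega> r \<le> C * (1 + real (\<omega> r))" using C that ab by simp
    also have "\<dots> \<le> C * (1 + real (\<omega> b))" using C(2) path_mono[OF \<omega>, of r b] that ab by simp
    finally show ?thesis .
  qed
  then have "integral {a..b} (rate \<omega>) \<le> integral {a..b} (\<lambda>_. C * (1 + real (\<omega> b)))"
    by (intro integral_le rate_integrable[OF \<omega>]) (use ab in auto)
  then show ?thesis
    using ab by (simp add: mult_ac)
qed

text \<open>A path leaves the levels up to \<open>z\<close> exactly by jumping from
  \<open>z\<close>. Hence the integral of the indicator of left limit \<open>z\<close> against the
  compensated process is minus the increment of this process.\<close>

definition level_process :: "nat \<Rightarrow> real \<Rightarrow> (real \<Rightarrow> nat) \<Rightarrow> real" where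
  "level_process z c \<omega> = (if \<omega> c \<le> z then 1 else 0) + integral {0..c} (rate_at z \<omega>)"

text \<open>The intensity enters at the single level \<open>z\<close> only, so the bound is uniform
  over all paths. It later permits the removal of the localising sequence.\<close>

lemma level_process_bounded:
  obtains B where "\<And>c \<omega>. \<omega> \<in> Omega \<Longrightarrow> 0 \<le> c \<Longrightarrow> c \<le> 1 \<Longrightarrow> \<bar>level_process z c \<omega>\<bar> \<le> B"
proof -
  obtain B where B: "0 \<le> B" "\<And>r w. r \<in> {0..1} \<Longrightarrow> w \<le> z \<Longrightarrow> \<bar>l r w\<bar> \<le> B"
    using path_bounded[of l z, OF cont] by metis
  have "\<bar>level_process z c \<omega>\<bar> \<le> 1 + B" if "\<omega> \<in> Omega" "0 \<le> c" "c \<le> 1" for c \<omega>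
  proof -
    have "norm (integral {0..c} (rate_at z \<omega>)) \<le> integral {0..c} (\<lambda>_. B)"
      by (intro integral_norm_bound_integral rate_at_integrable) (use that B in auto)
    also have "\<dots> \<le> B" using that B(1) by (simp add: mult_left_le_one_le)
    finally show ?thesis by (auto simp: level_process_def)
  qed
  with that show ?thesis by blast
qed

text \<open>On an interval containing at most one jump, the sum of the two increments only sees the
  part of the compensator accumulated after that jump.\<close>
lemma level_process_increment:
  assumes \<omega>: "\<omega> \<in> Omega" and ab: "0 \<le> a" "a \<le> b" "b \<le> 1" and T: "0 \<le> T"
    and small: "\<And>b'. a \<le> b' \<Longrightarrow> b' \<le> b \<Longrightarrow> \<omega> b' \<le> Suc (\<omega> a)"
    and K: "0 \<le> K" "\<And>r w. r \<in> {0..1} \<Longrightarrow> w \<le> \<omega> 1 \<Longrightarrow> \<bar>l r w\<bar> \<le> K"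
  shows "\<bar>(if \<omega> a = z then 1 else 0) * (compensated l (min b T) \<omega> - compensated l (min a T) \<omega>)
      + (level_process z (min b T) \<omega> - level_process z (min a T) \<omega>)\<bar>
    \<le> K * (b - a) * (real (\<omega> b) - real (\<omega> a))"
proof (cases "T \<le> a")
  case True
  \<comment> \<open>Both stopped processes are frozen on the interval, so the left-hand side is
    0.\<close>
  then show ?thesis using K(1) ab path_mono[OF \<omega> ab] by simp
next
  case False
  define b' where "b' = min b T"
  have b': "a \<le> b'" "b' \<le> b" "b' \<le> 1" "0 \<le> b'"
    using False ab by (auto simp: b'_def)
  have mono: "\<omega> a \<le> \<omega> b'" "\<omega> b' \<le> \<omega> b" "\<omega> b' \<le> Suc (\<omega> a)" "\<omega> b' \<le> \<omega> 1"
    using path_mono[OF \<omega>] b' ab small by auto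
  let ?i = "if \<omega> a = z then 1 else 0 :: real"
  have c: "compensated l b' \<omega> - compensated l a \<omega> = real (\<omega> b') - real (\<omega> a) - integral {a..b'} (rate \<omega>)"
    using integral_from_0_diff[OF rate_integrable[OF \<omega>], of a b'] b' ab by (simp add: compensated_eq[OF \<omega>])
  have d: "level_process z b' \<omega> - level_process z a \<omega>
      = (if \<omega> b' \<le> z then 1 else 0) - (if \<omega> a \<le> z then 1 else 0) + integral {a..b'} (rate_at z \<omega>)"
    using integral_from_0_diff[OF rate_at_integrable[OF \<omega>], of a b'] b' ab by (simp add: level_process_def)
  \<comment> \<open>Since the increment is 0 or 1, the path leaves the levels up to \<open>z\<close>
    iff it starts at \<open>z\<close> and jumps.\<close>
  have jump: "?i * (real (\<omega> b') - real (\<omega> a)) = (if \<omega> a \<le> z then 1 else 0) - (if \<omega> b' \<le> z then 1 else 0)"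
    using mono by (cases "\<omega> b' = \<omega> a") auto
  have int: "integral {a..b'} (rate_at z \<omega>) - ?i * integral {a..b'} (rate \<omega>)
      = integral {a..b'} (\<lambda>r. rate_at z \<omega> r - ?i * rate \<omega> r)"
    using b' ab rate_integrable[OF \<omega>, of a b'] rate_at_integrable[OF \<omega>, of a b' z]
    by (subst Henstock_Kurzweil_Integration.integral_diff) auto
  have "\<bar>integral {a..b'} (\<lambda>r. rate_at z \<omega> r - ?i * rate \<omega> r)\<bar> \<le> K * (b - a) * (real (\<omega> b) - real (\<omega> a))"
  proof (cases "\<omega> b' = \<omega> a")
    \<comment> \<open>Without a jump the path is constant and the two integrands cancel.\<close>
    case True
    have "integral {a..b'} (\<lambda>r. rate_at z \<omega> r - ?i * rate \<omega> r) = integral {a..b'} (\<lambda>r. 0)"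
    proof (rule integral_cong)
      fix r assume "r \<in> {a..b'}"
      then have "\<omega> r = \<omega> a"
        using path_mono[OF \<omega>, of a r] path_mono[OF \<omega>, of r b'] b' ab True by auto
      then show "rate_at z \<omega> r - ?i * rate \<omega> r = 0" by simp
    qed
    then show ?thesis using K(1) ab mono by simp
  next
    \<comment> \<open>After a jump the path has grown by at least 1, and this factor pays for the
      crude bound \<open>K * (b - a)\<close>.\<close>
    case False
    have "norm (integral {a..b'} (\<lambda>r. rate_at z \<omega> r - ?i * rate \<omega> r)) \<le> integral {a..b'} (\<lambda>_. K)"
    proof (rule integral_norm_bound_integral)
      show "(\<lambda>r. rate_at z \<omega> r - ?i * rate \<omega> r) integrable_on {a..b'}"
        using b' ab rate_integrable[OF \<omega>, of a b'] rate_at_integrable[OF \<omega>, of a b' z]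
        by (intro integrable_diff) auto
      fix r assume "r \<in> {a..b'}"
      then show "norm (rate_at z \<omega> r - ?i * rate \<omega> r) \<le> K"
        using K(1) K(2)[of r "\<omega> r"] path_mono[OF \<omega>, of r 1] b' ab by auto
    qed auto
    also have "\<dots> = K * (b' - a)" using b' by simp
    also have "\<dots> \<le> K * (b - a) * 1" using b' K(1) by (simp add: mult_left_mono)
    also have "\<dots> \<le> K * (b - a) * (real (\<omega> b) - real (\<omega> a))"
      using False mono K(1) ab by (intro mult_left_mono) auto
    finally show ?thesis by simp
  qed
  moreover have "i * (d - I) + (B - A + I') = I' - i * I" if "i * d = A - B" for i d A B I I' :: real
    using that by (simp add: algebra_simps)
  from this[OF jump] have "?i * (compensated l b' \<omega> - compensated l a \<omega>)
      + (level_process z b' \<omega> - level_process z a \<omega>)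
    = integral {a..b'} (\<lambda>r. rate_at z \<omega> r - ?i * rate \<omega> r)"
    unfolding c d int[symmetric] .
  moreover have "min a T = a" using False by simp
  ultimately show ?thesis
    unfolding b'_def[symmetric] by (simp only:)
qed

text \<open>These are Riemann sums of the stochastic integral of the indicator of level
  \<open>z\<close>. Once the telescoping increments of the level process are added,
  \<open>level_process_increment\<close> bounds each cell by \<open>K\<close> times the mesh times
  the growth of the path; the total is a constant of the path times the mesh.\<close>

lemma level_process_limit:
  fixes s t T :: real
  assumes \<omega>: "\<omega> \<in> Omega" and st: "0 \<le> s" "s \<le> t" "t \<le> 1" and T: "0 \<le> T"
  defines "\<theta> \<equiv> \<lambda>n i. s + (t - s) * real i / real (Suc n)"
  shows "(\<lambda>n. \<Sum>i<Suc n. (if \<omega> (\<theta> n i) = z then 1 else 0) *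
      (compensated l (min (\<theta> n (Suc i)) T) \<omega> - compensated l (min (\<theta> n i) T) \<omega>))
    \<longlonglongrightarrow> level_process z (min s T) \<omega> - level_process z (min t T) \<omega>"
proof -
  obtain \<delta> where \<delta>: "\<delta> > 0"
    "\<And>a b. 0 \<le> a \<Longrightarrow> a \<le> b \<Longrightarrow> b \<le> 1 \<Longrightarrow> b - a < \<delta> \<Longrightarrow> \<omega> b \<le> Suc (\<omega> a)"
    using path_small_increments[OF \<omega>] by blast
  obtain K where K: "0 \<le> K" "\<And>r w. r \<in> {0..1} \<Longrightarrow> w \<le> \<omega> 1 \<Longrightarrow> \<bar>l r w\<bar> \<le> K"
    using path_bounded[of l "\<omega> 1", OF cont] by metis
  define S where "S n = (\<Sum>i<Suc n. (if \<omega> (\<theta> n i) = z then 1 else 0) *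
      (compensated l (min (\<theta> n (Suc i)) T) \<omega> - compensated l (min (\<theta> n i) T) \<omega>))" for n
  define G where "G = level_process z (min t T) \<omega> - level_process z (min s T) \<omega>"
  have \<theta>0: "\<theta> n 0 = s" "\<theta> n (Suc n) = t" for n
    by (simp_all add: \<theta>_def del: of_nat_Suc)
  have \<theta>d: "\<theta> n (Suc i) - \<theta> n i = (t - s) / real (Suc n)" for n i
  proof -
    have "real (Suc i) = 1 + real i" by simp
    then show ?thesis unfolding \<theta>_def by (simp only: distrib_left add_divide_distrib)
  qed
  have \<theta>r: "s \<le> \<theta> n i" "\<theta> n i \<le> t" if "i \<le> Suc n" for n i
  proof -
    have "real i / real (Suc n) \<le> 1" using that by simp
    from mult_left_mono[OF this, of "t - s"] show "\<theta> n i \<le> t" using st by (simp add: \<theta>_def)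
    show "s \<le> \<theta> n i" using st by (simp add: \<theta>_def)
  qed
  have mesh: "(\<lambda>n. (t - s) / real (Suc n)) \<longlonglongrightarrow> 0"
    using LIMSEQ_Suc[OF lim_const_over_n[of "t - s"]] by simp
  \<comment> \<open>Eventually every cell is short enough for the path to grow by at most 1 on
    it.\<close>
  have "eventually (\<lambda>n. (t - s) / real (Suc n) < \<delta>) sequentially"
    using order_tendstoD(2)[OF mesh \<delta>(1)] .
  then have ev: "eventually (\<lambda>n. \<bar>S n + G\<bar> \<le> K * (real (\<omega> t) - real (\<omega> s)) * ((t - s) / real (Suc n))) sequentially"
  proof eventually_elim
    case (elim n)
    let ?e = "\<lambda>i. level_process z (min (\<theta> n (Suc i)) T) \<omega> - level_process z (min (\<theta> n i) T) \<omega>"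
    have "G = (\<Sum>i<Suc n. ?e i)"
      using sum_lessThan_telescope[of "\<lambda>i. level_process z (min (\<theta> n i) T) \<omega>" "Suc n"]
      by (simp only: G_def \<theta>0)
    then have "\<bar>S n + G\<bar> = \<bar>\<Sum>i<Suc n. (if \<omega> (\<theta> n i) = z then 1 else 0) *
      (compensated l (min (\<theta> n (Suc i)) T) \<omega> - compensated l (min (\<theta> n i) T) \<omega>) + ?e i\<bar>"
      by (simp only: S_def sum.distrib)
    also have "\<dots> \<le> (\<Sum>i<Suc n. K * ((t - s) / real (Suc n)) * (real (\<omega> (\<theta> n (Suc i))) - real (\<omega> (\<theta> n i))))"
    proof (rule order_trans[OF sum_abs], rule sum_mono)
      fix i assume "i \<in> {..<Suc n}"
      then have i: "i \<le> Suc n" "Suc i \<le> Suc n" by auto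
      have le: "0 \<le> \<theta> n i" "\<theta> n i \<le> \<theta> n (Suc i)" "\<theta> n (Suc i) \<le> 1"
        using \<theta>r[OF i(1)] \<theta>r[OF i(2)] \<theta>d[of n i] divide_nonneg_nonneg[of "t - s" "real (Suc n)"] st
        by linarith+
      show "\<bar>(if \<omega> (\<theta> n i) = z then 1 else 0) *
          (compensated l (min (\<theta> n (Suc i)) T) \<omega> - compensated l (min (\<theta> n i) T) \<omega>) + ?e i\<bar>
        \<le> K * ((t - s) / real (Suc n)) * (real (\<omega> (\<theta> n (Suc i))) - real (\<omega> (\<theta> n i)))"
        unfolding \<theta>d[of n i, symmetric]
        by (rule level_process_increment[OF \<omega> le T _ K])
           (use \<delta>(2) \<theta>d[of n i] elim le in auto)
    qed
    also have "\<dots> = K * ((t - s) / real (Suc n)) * (real (\<omega> t) - real (\<omega> s))"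
      using sum_lessThan_telescope[of "\<lambda>i. real (\<omega> (\<theta> n i))" "Suc n"]
      by (simp only: sum_distrib_left[symmetric] \<theta>0)
    finally show ?case by (simp only: mult_ac)
  qed
  have "(\<lambda>n. K * (real (\<omega> t) - real (\<omega> s)) * ((t - s) / real (Suc n))) \<longlonglongrightarrow> 0"
    using tendsto_mult_right_zero[OF mesh] .
  then have "(\<lambda>n. S n + G) \<longlonglongrightarrow> 0"
    by (rule Lim_null_comparison[rotated]) (use ev in simp)
  from tendsto_diff[OF this tendsto_const[of G]]
  have "S \<longlonglongrightarrow> - G" by simp
  then show ?thesis unfolding S_def G_def by simp
qed

end

subsection \<open>The level martingales\<close>

locale counting_process = intensity l + prob_space P
  for l :: "real \<Rightarrow> nat \<Rightarrow> real" and P :: "(real \<Rightarrow> nat) measure" +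
  assumes sets_P: "sets P = sets canonical"
    and local_martingale: "local_martingale_on P (compensated l)"
begin

lemma space_P [simp]: "space P = Omega"
  using sets_eq_imp_space_eq[OF sets_P] by simp

lemma filt_sets_P: "t \<le> 1 \<Longrightarrow> A \<in> sets (filt t) \<Longrightarrow> A \<in> sets P"
  using filt_subset_canonical sets_P by blast

lemma measurable_P_eval: "0 \<le> r \<Longrightarrow> r \<le> 1 \<Longrightarrow> (\<lambda>\<omega>. \<omega> r) \<in> measurable P (count_space UNIV)"
  using measurable_eval measurable_cong_sets[OF sets_P refl] by blast

lemma martingale_increment:
  assumes M: "martingale_on P M" and st: "0 \<le> s" "s \<le> t" "t \<le> 1" and A: "A \<in> sets (filt s)"
  shows "(\<integral>\<omega>. indicator A \<omega> * (M t \<omega> - M s \<omega>) \<partial>P) = 0"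
proof -
  have "subalgebra P (filt s)"
    using st filt_sets_P[of s] by (auto simp: subalgebra_def)
  then interpret finite_measure_subalgebra P "filt s"
    by unfold_locales
  have I: "integrable P (M t)" "integrable P (M s)"
    using M st by (auto simp: martingale_on_def)
  have AP: "A \<in> sets P" using filt_sets_P[OF _ A] st by simp
  have iA: "integrable P (\<lambda>\<omega>. indicator A \<omega> * M t \<omega>)" "integrable P (\<lambda>\<omega>. indicator A \<omega> * M s \<omega>)"
    using integrable_mult_indicator[OF AP I(1)] integrable_mult_indicator[OF AP I(2)] by simp_all
  have "(\<integral>\<omega>\<in>A. M t \<omega> \<partial>P) = (\<integral>\<omega>\<in>A. real_cond_exp P (filt s) (M t) \<omega> \<partial>P)"
    by (rule real_cond_exp_intA[OF I(1) A])
  also have "\<dots> = (\<integral>\<omega>\<in>A. M s \<omega> \<partial>P)"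
    unfolding set_lebesgue_integral_def
  proof (rule integral_cong_AE)
    show "AE \<omega> in P. indicat_real A \<omega> *\<^sub>R real_cond_exp P (filt s) (M t) \<omega> = indicat_real A \<omega> *\<^sub>R M s \<omega>"
    proof -
      have "AE \<omega> in P. real_cond_exp P (filt s) (M t) \<omega> = M s \<omega>"
        using M st unfolding martingale_on_def by blast
      then show ?thesis by eventually_elim simp
    qed
  qed (use AP I in measurable)
  finally show ?thesis
    using iA by (simp add: set_lebesgue_integral_def right_diff_distrib)
qed

context
  fixes \<tau> :: "(real \<Rightarrow> nat) \<Rightarrow> real"
  assumes stop: "stopping_time filt \<tau>" and \<tau>_nonneg: "\<And>\<omega>. 0 \<le> \<tau> \<omega>"
    and mart: "martingale_on P (\<lambda>t \<omega>. compensated l (min t (\<tau> \<omega>)) \<omega>)"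
begin

lemma stopped_measurable:
  "0 \<le> t \<Longrightarrow> t \<le> 1 \<Longrightarrow> (\<lambda>\<omega>. real (\<omega> (min t (\<tau> \<omega>)))) \<in> borel_measurable P"
  using measurable_compose[OF measurable_stopped_eval[OF stop \<tau>_nonneg], where g=real and L=borel]
    measurable_cong_sets[OF sets_P refl] by auto

lemma stopped_compensated_integrable:
  "0 \<le> t \<Longrightarrow> t \<le> 1 \<Longrightarrow> integrable P (\<lambda>\<omega>. compensated l (min t (\<tau> \<omega>)) \<omega>)"
  using mart by (auto simp: martingale_on_def)

lemma start_le_sets: "{\<omega>\<in>Omega. \<omega> 0 \<le> z} \<in> sets P"
  using eval_le_sets[of 0 z] sets_P by simp

text \<open>On a grid of mesh \<open>1/m\<close> with \<open>m > 2C\<close>, where \<open>l(t, z) \<le> C (1 + z)\<close>, the growth of the compensator over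
  one step is at most half of the new value of the path, so integrability propagates along the grid.\<close>
lemma stopped_integrable:
  "integrable P (\<lambda>\<omega>. indicator {\<omega>\<in>Omega. \<omega> 0 \<le> z} \<omega> * real (\<omega> (min 1 (\<tau> \<omega>))))"
proof -
  obtain C where C: "0 < C" "\<And>t z. t \<in> {0..1} \<Longrightarrow> l t z \<le> C * (1 + real z)"
    using linear_growth by blast
  obtain m where m: "2 * C < real m" using reals_Archimedean2 by blast
  have m0: "m > 0" using C(1) m by (cases m) auto
  \<comment> \<open>The initial value need not be integrable. On \<open>B\<close> it is bounded,
    which starts the induction, and paths starting above \<open>z\<close> never visit level
    \<open>z\<close>.\<close>
  define B where "B = {\<omega>\<in>Omega. \<omega> 0 \<le> z}"
  define M where "M t \<omega> = compensated l (min t (\<tau> \<omega>)) \<omega>" for t \<omega>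
  have B [measurable]: "B \<in> sets P" unfolding B_def by (rule start_le_sets)
  have "integrable P (\<lambda>\<omega>. indicator B \<omega> * real (\<omega> (min (real k / real m) (\<tau> \<omega>))))" if "k \<le> m" for k
    using that
  proof (induction k)
    case 0
    have [measurable]: "(\<lambda>\<omega>. real (\<omega> 0)) \<in> borel_measurable P"
      using stopped_measurable[of 0] \<tau>_nonneg by (simp add: min_absorb1)
    have "integrable P (\<lambda>\<omega>. indicator B \<omega> * real (\<omega> 0))"
      by (rule Bochner_Integration.integrable_bound[where f="\<lambda>_. real z"])
         (measurable, auto simp: B_def indicator_def)
    then show ?case using \<tau>_nonneg by (simp add: min_absorb1)
  next
    case (Suc k)
    define a b where "a = real k / real m" and "b = real (Suc k) / real m"
    have ab: "0 \<le> a" "a \<le> b" "b \<le> 1" "b - a = 1 / real m"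
      using Suc.prems m0 by (auto simp: a_def b_def field_simps)
    have I: "integrable P (M a)" "integrable P (M b)"
      unfolding M_def using stopped_compensated_integrable ab by auto
    have IH: "integrable P (\<lambda>\<omega>. indicator B \<omega> * real (\<omega> (min a (\<tau> \<omega>))))"
      using Suc by (simp add: a_def)
    have "integrable P (\<lambda>\<omega>. indicator B \<omega> * real (\<omega> (min b (\<tau> \<omega>))))"
    proof (rule Bochner_Integration.integrable_bound)
      show "integrable P (\<lambda>\<omega>. 2 * \<bar>M b \<omega> - M a \<omega>\<bar> + 1 + 2 * (indicator B \<omega> * real (\<omega> (min a (\<tau> \<omega>)))))"
        using I IH by (intro Bochner_Integration.integrable_add integrable_mult_right integrable_abs
          Bochner_Integration.integrable_diff integrable_const)
      show "(\<lambda>\<omega>. indicator B \<omega> * real (\<omega> (min b (\<tau> \<omega>)))) \<in> borel_measurable P"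
        using stopped_measurable[of b] ab by (intro borel_measurable_times borel_measurable_indicator B) auto
      show "AE \<omega> in P. norm (indicator B \<omega> * real (\<omega> (min b (\<tau> \<omega>))))
          \<le> norm (2 * \<bar>M b \<omega> - M a \<omega>\<bar> + 1 + 2 * (indicator B \<omega> * real (\<omega> (min a (\<tau> \<omega>)))))"
      proof (rule AE_I2)
        fix \<omega> assume "\<omega> \<in> space P"
        then have \<omega>: "\<omega> \<in> Omega" by simp
        define a' b' where "a' = min a (\<tau> \<omega>)" and "b' = min b (\<tau> \<omega>)"
        have ab': "0 \<le> a'" "a' \<le> b'" "b' \<le> 1" "b' - a' \<le> 1 / real m"
          using ab \<tau>_nonneg[of \<omega>] by (auto simp: a'_def b'_def)
        define I where "I = integral {a'..b'} (rate \<omega>)"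
        have "M b \<omega> - M a \<omega> = real (\<omega> b') - real (\<omega> a') - I"
          using integral_from_0_diff[OF rate_integrable[OF \<omega>], of a' b'] ab'
          by (simp add: M_def compensated_eq[OF \<omega>] I_def a'_def[symmetric] b'_def[symmetric])
        moreover have "I \<le> C * (1 + real (\<omega> b')) * (b' - a')"
          unfolding I_def by (rule rate_integral_bound[OF C(2,1) \<omega> ab'(1-3)])
        moreover have "C * (1 + real (\<omega> b')) * (b' - a') \<le> C * (1 + real (\<omega> b')) * (1 / real m)"
          using ab' C(1) by (intro mult_left_mono) auto
        moreover have "C * (1 + real (\<omega> b')) * (1 / real m) = (C / real m) * (1 + real (\<omega> b'))"
          by simp
        moreover have "(C / real m) * (1 + real (\<omega> b')) \<le> (1 / 2) * (1 + real (\<omega> b'))"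
          using m m0 by (intro mult_right_mono) (auto simp: field_simps)
        \<comment> \<open>Half of \<open>\<omega> b'\<close> is absorbed into the left-hand side,
          and the inequality is doubled.\<close>
        ultimately have "real (\<omega> b') \<le> 2 * \<bar>M b \<omega> - M a \<omega>\<bar> + 1 + 2 * real (\<omega> a')"
          by argo
        then show "norm (indicator B \<omega> * real (\<omega> (min b (\<tau> \<omega>))))
          \<le> norm (2 * \<bar>M b \<omega> - M a \<omega>\<bar> + 1 + 2 * (indicator B \<omega> * real (\<omega> (min a (\<tau> \<omega>)))))"
          by (auto simp: a'_def b'_def indicator_def)
      qed
    qed
    then show ?case by (simp only: b_def)
  qed
  from this[of m] show ?thesis using m0 by (simp add: B_def)
qed

text \<open>Each Riemann sum weights martingale increments with events of their past and has
  expectation 0. The sums converge pathwise to \<open>D\<close>, and dominated convergence carries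
  the expectation over.\<close>

lemma stopped_level_process:
  fixes z :: nat and s t :: real
  assumes st: "0 \<le> s" "s \<le> t" "t \<le> 1" and A: "A \<in> sets (filt s)"
  defines "D \<equiv> \<lambda>\<omega>. indicator A \<omega> * (level_process z (min s (\<tau> \<omega>)) \<omega> - level_process z (min t (\<tau> \<omega>)) \<omega>)"
  shows "D \<in> borel_measurable P" "integral\<^sup>L P D = 0"
proof -
  define M where "M t \<omega> = compensated l (min t (\<tau> \<omega>)) \<omega>" for t \<omega>
  define \<theta> where "\<theta> n i = s + (t - s) * real i / real (Suc n)" for n i
  define H where "H n i = A \<inter> {\<omega>\<in>Omega. \<omega> (\<theta> n i) = z}" for n i
  define S where "S n \<omega> = (\<Sum>i<Suc n. indicator (H n i) \<omega> * (M (\<theta> n (Suc i)) \<omega> - M (\<theta> n i) \<omega>))" for n \<omega>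
  \<comment> \<open>The sums are bounded by the growth over [0,1] of the stopped path plus its
    compensator. Eliminating the compensator through \<open>M 1\<close> leaves twice the growth of
    the path minus \<open>M 1\<close>, which \<open>w\<close> dominates for starts at most
    \<open>z\<close>.\<close>
  define w where "w \<omega> = 2 * (indicator {\<omega>\<in>Omega. \<omega> 0 \<le> z} \<omega> * real (\<omega> (min 1 (\<tau> \<omega>)))) + \<bar>M 1 \<omega>\<bar>" for \<omega>
  have \<theta>0: "\<theta> n 0 = s" "\<theta> n (Suc n) = t" for n
    by (simp_all add: \<theta>_def del: of_nat_Suc)
  have \<theta>m: "\<theta> n i \<le> \<theta> n j" if "i \<le> j" for n i j
    using that st by (auto simp: \<theta>_def intro!: divide_right_mono mult_left_mono)
  have \<theta>r: "s \<le> \<theta> n i" "\<theta> n i \<le> t" if "i \<le> Suc n" for n i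
    using \<theta>m[of 0 i n] \<theta>m[of i "Suc n" n] that unfolding \<theta>0 by auto
  have mi: "integrable P (M r)" if "0 \<le> r" "r \<le> 1" for r
    unfolding M_def using stopped_compensated_integrable that by auto
  have Hs: "H n i \<in> sets (filt (\<theta> n i))" if "i \<le> Suc n" for n i
  proof -
    have "A \<in> sets (filt (\<theta> n i))" using filt_mono[OF \<theta>r(1)[OF that]] A by blast
    then show ?thesis unfolding H_def using \<theta>r[OF that] st by (intro sets.Int filt_eval) auto
  qed
  have HP: "H n i \<in> sets P" if "i \<le> Suc n" for n i
    using filt_sets_P[OF _ Hs[OF that]] \<theta>r[OF that] st by simp
  have term_int: "integrable P (\<lambda>\<omega>. indicator (H n i) \<omega> * (M (\<theta> n (Suc i)) \<omega> - M (\<theta> n i) \<omega>))" if "i < Suc n" for n i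
    using integrable_mult_indicator[OF HP, of i n "\<lambda>\<omega>. M (\<theta> n (Suc i)) \<omega> - M (\<theta> n i) \<omega>"]
      mi[of "\<theta> n i"] mi[of "\<theta> n (Suc i)"] \<theta>r[of i n] \<theta>r[of "Suc i" n] that st by simp
  have Sint: "integrable P (S n)" for n
    unfolding S_def using term_int by (intro Bochner_Integration.integrable_sum) auto
  have S0: "integral\<^sup>L P (S n) = 0" for n
  proof -
    have "integral\<^sup>L P (S n) = (\<Sum>i<Suc n. \<integral>\<omega>. indicator (H n i) \<omega> * (M (\<theta> n (Suc i)) \<omega> - M (\<theta> n i) \<omega>) \<partial>P)"
      unfolding S_def using term_int by (intro Bochner_Integration.integral_sum) auto
    also have "\<dots> = 0"
    proof (rule sum.neutral, rule ballI)
      fix i assume "i \<in> {..<Suc n}"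
      then show "(\<integral>\<omega>. indicator (H n i) \<omega> * (M (\<theta> n (Suc i)) \<omega> - M (\<theta> n i) \<omega>) \<partial>P) = 0"
        unfolding M_def
        by (intro martingale_increment[OF mart] Hs) (use \<theta>r[of i n] \<theta>r[of "Suc i" n] \<theta>m[of i "Suc i" n] st in auto)
    qed
    finally show ?thesis .
  qed
  have lim: "(\<lambda>n. S n \<omega>) \<longlonglongrightarrow> D \<omega>" if \<omega>: "\<omega> \<in> Omega" for \<omega>
  proof -
    have "S n \<omega> = indicator A \<omega> * (\<Sum>i<Suc n. (if \<omega> (\<theta> n i) = z then 1 else 0) *
      (compensated l (min (\<theta> n (Suc i)) (\<tau> \<omega>)) \<omega> - compensated l (min (\<theta> n i) (\<tau> \<omega>)) \<omega>))" for n
      unfolding S_def sum_distrib_left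
      by (intro sum.cong) (use \<omega> in \<open>auto simp: H_def M_def indicator_def\<close>)
    then show ?thesis
      using tendsto_mult_left[OF level_process_limit[OF \<omega> st \<tau>_nonneg, of z], of "indicator A \<omega>"]
      by (simp only: D_def \<theta>_def)
  qed
  have dom: "\<bar>S n \<omega>\<bar> \<le> w \<omega>" if \<omega>: "\<omega> \<in> Omega" for n \<omega>
  proof (cases "\<omega> 0 \<le> z")
    case False
    have "indicator (H n i) \<omega> = (0::real)" if "i < Suc n" for i
      using path_mono[OF \<omega>, of 0 "\<theta> n i"] \<theta>r[of i n] that st False by (auto simp: H_def indicator_def)
    then have "S n \<omega> = 0" by (simp add: S_def)
    then show ?thesis by (simp add: w_def)
  next
    case True
    define Q where "Q r = real (\<omega> (min r (\<tau> \<omega>))) + integral {0..min r (\<tau> \<omega>)} (rate \<omega>)" for r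
    have Meq: "M r \<omega> = real (\<omega> (min r (\<tau> \<omega>))) - real (\<omega> 0) - integral {0..min r (\<tau> \<omega>)} (rate \<omega>)"
      if "0 \<le> r" "r \<le> 1" for r
      unfolding M_def using that \<tau>_nonneg[of \<omega>] by (intro compensated_eq[OF \<omega>]) auto
    \<comment> \<open>Path and compensator are both nondecreasing; they enter \<open>M\<close> with
      opposite signs and \<open>Q\<close> with equal signs.\<close>
    have incr: "\<bar>M b \<omega> - M a \<omega>\<bar> \<le> Q b - Q a" if ab: "0 \<le> a" "a \<le> b" "b \<le> 1" for a b
    proof -
      define a' b' where "a' = min a (\<tau> \<omega>)" and "b' = min b (\<tau> \<omega>)"
      have ab': "0 \<le> a'" "a' \<le> b'" "b' \<le> 1"
        using ab \<tau>_nonneg[of \<omega>] by (auto simp: a'_def b'_def)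
      have "0 \<le> integral {a'..b'} (rate \<omega>)"
        using ab' by (intro integral_nonneg rate_integrable[OF \<omega>] nonneg) auto
      moreover have "integral {0..b'} (rate \<omega>) - integral {0..a'} (rate \<omega>) = integral {a'..b'} (rate \<omega>)"
        using integral_from_0_diff[OF rate_integrable[OF \<omega>] ab'] by simp
      moreover have "real (\<omega> a') \<le> real (\<omega> b')"
        using path_mono[OF \<omega> ab'] by simp
      moreover have "M a \<omega> = real (\<omega> a') - real (\<omega> 0) - integral {0..a'} (rate \<omega>)"
        "M b \<omega> = real (\<omega> b') - real (\<omega> 0) - integral {0..b'} (rate \<omega>)"
        using Meq ab by (auto simp: a'_def b'_def)
      moreover have "Q b - Q a = real (\<omega> b') + integral {0..b'} (rate \<omega>) - (real (\<omega> a') + integral {0..a'} (rate \<omega>))"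
        by (simp add: Q_def a'_def b'_def)
      ultimately show ?thesis by linarith
    qed
    have "\<bar>S n \<omega>\<bar> \<le> (\<Sum>i<Suc n. Q (\<theta> n (Suc i)) - Q (\<theta> n i))"
      unfolding S_def
    proof (rule order_trans[OF sum_abs], rule sum_mono)
      fix i assume "i \<in> {..<Suc n}"
      then have "\<bar>M (\<theta> n (Suc i)) \<omega> - M (\<theta> n i) \<omega>\<bar> \<le> Q (\<theta> n (Suc i)) - Q (\<theta> n i)"
        by (intro incr) (use \<theta>r[of i n] \<theta>r[of "Suc i" n] \<theta>m[of i "Suc i" n] st in auto)
      then show "\<bar>indicator (H n i) \<omega> * (M (\<theta> n (Suc i)) \<omega> - M (\<theta> n i) \<omega>)\<bar> \<le> Q (\<theta> n (Suc i)) - Q (\<theta> n i)"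
        by (auto simp: indicator_def)
    qed
    also have "\<dots> = Q t - Q s"
      using sum_lessThan_telescope[of "\<lambda>i. Q (\<theta> n i)" "Suc n"] by (simp only: \<theta>0)
    also have "\<dots> \<le> Q 1 - Q 0"
      using incr[of 0 s] incr[of t 1] st by auto
    also have "\<dots> \<le> w \<omega>"
      using Meq[of 1] True \<omega> \<tau>_nonneg[of \<omega>] by (auto simp: Q_def w_def min_absorb1)
    finally show ?thesis .
  qed
  have wint: "integrable P w"
    unfolding w_def using stopped_integrable mi[of 1]
    by (intro Bochner_Integration.integrable_add integrable_mult_right integrable_abs) auto
  show D: "D \<in> borel_measurable P"
  proof (rule borel_measurable_LIMSEQ_real)
    show "\<And>\<omega>. \<omega> \<in> space P \<Longrightarrow> (\<lambda>n. S n \<omega>) \<longlonglongrightarrow> D \<omega>" using lim by simp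
    show "\<And>n. S n \<in> borel_measurable P" using Sint by (rule borel_measurable_integrable)
  qed
  have "(\<lambda>n. integral\<^sup>L P (S n)) \<longlonglongrightarrow> integral\<^sup>L P D"
  proof (rule integral_dominated_convergence[where w=w])
    show "D \<in> borel_measurable P" by (rule D)
    show "integrable P w" by (rule wint)
    show "\<And>n. S n \<in> borel_measurable P" using Sint by (rule borel_measurable_integrable)
    show "AE \<omega> in P. (\<lambda>n. S n \<omega>) \<longlonglongrightarrow> D \<omega>" using lim by (intro AE_I2) simp
    show "\<And>n. AE \<omega> in P. norm (S n \<omega>) \<le> w \<omega>" using dom by (intro AE_I2) simp
  qed
  then show "integral\<^sup>L P D = 0"
    unfolding S0 by (simp add: LIMSEQ_const_iff)
qed

end

end

subsection \<open>The forward equation\<close>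

lemma has_field_derivative_transform_on:
  assumes "x \<in> S" "\<And>x. x \<in> S \<Longrightarrow> g x = f x" "(f has_field_derivative f') (at x within S)"
  shows "(g has_field_derivative f') (at x within S)"
  using has_derivative_transform[OF assms(1,2)] assms(3) by (simp add: has_field_derivative_def)

context counting_process
begin

text \<open>Fubini's theorem for time and path: joint measurability of the evaluation and
  boundedness of the intensity at the single level \<open>z\<close> make the integrand integrable on
  the product.\<close>

lemma occupation_fubini:
  assumes A: "A \<in> sets P" and c: "0 \<le> c" "c \<le> 1"
  shows "(\<lambda>\<omega>. indicator A \<omega> * integral {0..c} (rate_at z \<omega>)) \<in> borel_measurable P"
    and "(\<lambda>r. l r z * prob {\<omega>\<in>A. \<omega> r = z}) integrable_on {0..c}"
    and "(\<integral>\<omega>. indicator A \<omega> * integral {0..c} (rate_at z \<omega>) \<partial>P) = integral {0..c} (\<lambda>r. l r z * prob {\<omega>\<in>A. \<omega> r = z})"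
proof -
  interpret pair_sigma_finite lborel P
    by unfold_locales
  obtain B where B: "0 \<le> B" "\<And>r w. r \<in> {0..1} \<Longrightarrow> w \<le> z \<Longrightarrow> \<bar>l r w\<bar> \<le> B"
    using path_bounded[of l z, OF cont] by metis
  \<comment> \<open>Clamping gives joint measurability over all real times; the indicator confines
    time to \<open>{0..c}\<close>, where clamping changes nothing.\<close>
  define g where "g r \<omega> = indicator {0..c} r * (l (clamp01 r) z * (indicator A \<omega> * indicator {z} (\<omega> (clamp01 r))))"
    for r and \<omega> :: "real \<Rightarrow> nat"
  have AO: "A \<subseteq> Omega" using sets.sets_into_space[OF A] by simp
  have "measurable ((lborel :: real measure) \<Otimes>\<^sub>M P) (count_space UNIV) = measurable (borel \<Otimes>\<^sub>M canonical) (count_space (UNIV :: nat set))"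
    by (intro measurable_cong_sets sets_pair_measure_cong sets_lborel sets_P refl)
  then have ev: "(\<lambda>x. snd x (clamp01 (fst x))) \<in> measurable (lborel \<Otimes>\<^sub>M P) (count_space UNIV)"
    using measurable_eval_pair by (simp only: case_prod_unfold)
  have [measurable]: "(\<lambda>r. l (clamp01 r) z) \<in> borel_measurable borel"
    by (intro borel_measurable_continuous_onI continuous_on_compose2[OF cont[of z]] continuous_clamp01) auto
  have m1: "(\<lambda>x. indicator {z} (snd x (clamp01 (fst x))) :: real) \<in> borel_measurable (lborel \<Otimes>\<^sub>M P)"
    using measurable_compose[OF ev, of "indicator {z}" borel] by simp
  have m2: "(\<lambda>x. l (clamp01 (fst x)) z) \<in> borel_measurable (lborel \<Otimes>\<^sub>M P)"
    by measurable
  note A [measurable]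
  have gm: "(\<lambda>(r, \<omega>). g r \<omega>) \<in> borel_measurable (lborel \<Otimes>\<^sub>M P)"
    unfolding g_def case_prod_beta by (intro borel_measurable_times m1 m2) measurable
  have gi: "integrable (lborel \<Otimes>\<^sub>M P) (\<lambda>(r, \<omega>). g r \<omega>)"
  proof (rule integrableI_bounded_set[where A="{0..c} \<times> space P" and B=B])
    show "{0..c} \<times> space P \<in> sets (lborel \<Otimes>\<^sub>M P)" by (intro pair_measureI sets.top) simp
    show "emeasure (lborel \<Otimes>\<^sub>M P) ({0..c} \<times> space P) < \<infinity>"
    proof -
      have "sigma_finite_measure P" by unfold_locales
      then have "emeasure (lborel \<Otimes>\<^sub>M P) ({0..c} \<times> space P) = emeasure lborel {0..c} * emeasure P (space P)"
        by (rule sigma_finite_measure.emeasure_pair_measure_Times) (rule sets.top | simp)+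
      then show ?thesis using c by (simp add: emeasure_space_1 del: space_P)
    qed
    show "AE x in lborel \<Otimes>\<^sub>M P. x \<in> {0..c} \<times> space P \<longrightarrow> norm (case x of (r, \<omega>) \<Rightarrow> g r \<omega>) \<le> B"
      using B by (intro AE_I2) (auto simp: g_def indicator_def)
    show "AE x in lborel \<Otimes>\<^sub>M P. x \<notin> {0..c} \<times> space P \<longrightarrow> (case x of (r, \<omega>) \<Rightarrow> g r \<omega>) = 0"
      by (intro AE_I2) (auto simp: g_def indicator_def space_pair_measure)
  qed (rule gm)
  have inner: "(\<integral>r. g r \<omega> \<partial>lborel) = indicator A \<omega> * integral {0..c} (rate_at z \<omega>)" if \<omega>: "\<omega> \<in> Omega" for \<omega>
  proof -
    have "(LINT r:{0..c}|lborel. rate_at z \<omega> r) = integral {0..c} (rate_at z \<omega>)"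
      by (intro set_borel_integral_eq_integral(2) set_integrable_subset[OF
            path_set_integrable[of "\<lambda>r w. if w = z then l r w else 0", OF cont_at_level \<omega>]])
         (use c in auto)
    moreover have "(\<integral>r. g r \<omega> \<partial>lborel) = (\<integral>r. indicator A \<omega> * (indicator {0..c} r *\<^sub>R rate_at z \<omega> r) \<partial>lborel)"
    proof (rule Bochner_Integration.integral_cong)
      show "g r \<omega> = indicator A \<omega> * (indicator {0..c} r *\<^sub>R rate_at z \<omega> r)" for r
        using c by (cases "r \<in> {0..c}"; cases "\<omega> r = z") (simp_all add: g_def)
    qed (rule refl)
    ultimately show ?thesis
      unfolding set_lebesgue_integral_def by (simp only: integral_mult_right_zero)
  qed
  have pe: "(\<integral>\<omega>. g r \<omega> \<partial>P) = indicator {0..c} r *\<^sub>R (l r z * prob {\<omega>\<in>A. \<omega> r = z})" for r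
  proof (cases "r \<in> {0..c}")
    case True
    have "{\<omega>\<in>A. \<omega> r = z} = A \<inter> {\<omega>\<in>Omega. \<omega> r = z}" using AO by auto
    moreover have "{\<omega>\<in>Omega. \<omega> r = z} \<in> sets P" using filt_sets_P[OF _ filt_eval[of r 1 z]] True c by auto
    ultimately have S: "{\<omega>\<in>A. \<omega> r = z} \<in> sets P" using A by auto
    have "(\<integral>\<omega>. g r \<omega> \<partial>P) = (\<integral>\<omega>. l r z * indicator {\<omega>\<in>A. \<omega> r = z} \<omega> \<partial>P)"
      by (intro Bochner_Integration.integral_cong) (use True c in \<open>auto simp: g_def indicator_def\<close>)
    also have "\<dots> = l r z * prob {\<omega>\<in>A. \<omega> r = z}" using S sets.sets_into_space[OF S] by (simp add: Int_absorb2)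
    finally show ?thesis using True by simp
  qed (simp add: g_def)
  have meas: "(\<lambda>\<omega>. \<integral>r. g r \<omega> \<partial>lborel) \<in> borel_measurable P"
    using gm by measurable
  show "(\<lambda>\<omega>. indicator A \<omega> * integral {0..c} (rate_at z \<omega>)) \<in> borel_measurable P"
    using meas by (rule measurable_cong[THEN iffD1, rotated]) (simp add: inner)
  have "integrable lborel (\<lambda>r. \<integral>\<omega>. g r \<omega> \<partial>P)"
    using integrable_fst'[OF gi] by simp
  then have si: "set_integrable lborel {0..c} (\<lambda>r. l r z * prob {\<omega>\<in>A. \<omega> r = z})"
    unfolding pe set_integrable_def .
  show "(\<lambda>r. l r z * prob {\<omega>\<in>A. \<omega> r = z}) integrable_on {0..c}"
    by (rule set_borel_integral_eq_integral(1)[OF si])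
  have "(\<integral>\<omega>. indicator A \<omega> * integral {0..c} (rate_at z \<omega>) \<partial>P) = (\<integral>\<omega>. \<integral>r. g r \<omega> \<partial>lborel \<partial>P)"
    by (intro Bochner_Integration.integral_cong) (simp_all add: inner)
  also have "\<dots> = (\<integral>r. \<integral>\<omega>. g r \<omega> \<partial>P \<partial>lborel)"
    by (rule Fubini_integral[OF gi])
  also have "\<dots> = integral {0..c} (\<lambda>r. l r z * prob {\<omega>\<in>A. \<omega> r = z})"
    unfolding pe set_borel_integral_eq_integral(2)[OF si, symmetric] set_lebesgue_integral_def ..
  finally show "(\<integral>\<omega>. indicator A \<omega> * integral {0..c} (rate_at z \<omega>) \<partial>P) = integral {0..c} (\<lambda>r. l r z * prob {\<omega>\<in>A. \<omega> r = z})" .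
qed

lemma le_sets_P: "A \<in> sets P \<Longrightarrow> 0 \<le> c \<Longrightarrow> c \<le> 1 \<Longrightarrow> {\<omega>\<in>A. \<omega> c \<le> z} \<in> sets P"
proof -
  assume A: "A \<in> sets P" and c: "0 \<le> c" "c \<le> 1"
  have "{\<omega>\<in>A. \<omega> c \<le> z} = A \<inter> {\<omega>\<in>Omega. \<omega> c \<le> z}" using sets.sets_into_space[OF A] by auto
  then show ?thesis using A eval_le_sets[OF c, of z] sets_P by auto
qed

lemma eq_sets_P: "A \<in> sets P \<Longrightarrow> 0 \<le> c \<Longrightarrow> c \<le> 1 \<Longrightarrow> {\<omega>\<in>A. \<omega> c = z} \<in> sets P"
proof -
  assume A: "A \<in> sets P" and c: "0 \<le> c" "c \<le> 1"
  have "{\<omega>\<in>A. \<omega> c = z} = A \<inter> {\<omega>\<in>Omega. \<omega> c = z}" using sets.sets_into_space[OF A] by auto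
  then show ?thesis using A filt_sets_P[OF _ filt_eval[of c 1 z]] c by auto
qed

lemma level_process_expectation:
  assumes A: "A \<in> sets P" and c: "0 \<le> c" "c \<le> 1"
  shows "integrable P (\<lambda>\<omega>. indicator A \<omega> * level_process z c \<omega>)"
    and "(\<integral>\<omega>. indicator A \<omega> * level_process z c \<omega> \<partial>P)
      = prob {\<omega>\<in>A. \<omega> c \<le> z} + integral {0..c} (\<lambda>r. l r z * prob {\<omega>\<in>A. \<omega> r = z})"
proof -
  let ?L = "{\<omega>\<in>A. \<omega> c \<le> z}"
  obtain B where B: "\<And>\<omega>. \<omega> \<in> Omega \<Longrightarrow> \<bar>level_process z c \<omega>\<bar> \<le> B"
    using level_process_bounded[of z] c by metis
  have L: "?L \<in> sets P" by (rule le_sets_P[OF A c])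
  have eq: "indicator A \<omega> * level_process z c \<omega> = indicator ?L \<omega> + indicator A \<omega> * integral {0..c} (rate_at z \<omega>)" for \<omega>
    by (auto simp: indicator_def level_process_def)
  have "(\<lambda>\<omega>. indicator ?L \<omega> + indicator A \<omega> * integral {0..c} (rate_at z \<omega>)) \<in> borel_measurable P"
    by (intro borel_measurable_add occupation_fubini(1)[OF A c] borel_measurable_indicator L)
  then have m: "(\<lambda>\<omega>. indicator A \<omega> * level_process z c \<omega>) \<in> borel_measurable P"
    unfolding eq .
  have bd: "\<bar>indicator A \<omega> * level_process z c \<omega>\<bar> \<le> B" if "\<omega> \<in> Omega" for \<omega>
    using B[OF that] by (auto simp: indicator_def)
  show int: "integrable P (\<lambda>\<omega>. indicator A \<omega> * level_process z c \<omega>)"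
    by (rule integrable_const_bound[where B=B]) (use bd m in auto)
  have iL: "integrable P (indicator ?L :: _ \<Rightarrow> real)" using L by (intro integrable_real_indicator) (auto simp: emeasure_eq_measure)
  have "integrable P (\<lambda>\<omega>. indicator A \<omega> * level_process z c \<omega> - indicator ?L \<omega>)"
    using int iL by (rule Bochner_Integration.integrable_diff)
  then have iI: "integrable P (\<lambda>\<omega>. indicator A \<omega> * integral {0..c} (rate_at z \<omega>))"
    unfolding eq by simp
  show "(\<integral>\<omega>. indicator A \<omega> * level_process z c \<omega> \<partial>P)
      = prob ?L + integral {0..c} (\<lambda>r. l r z * prob {\<omega>\<in>A. \<omega> r = z})"
    unfolding eq Bochner_Integration.integral_add[OF iL iI] occupation_fubini(3)[OF A c]
    using L sets.sets_into_space[OF L] by (simp add: Int_absorb2)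
qed

text \<open>Removal of the localisation: on almost every path the stopping times eventually stay
  above 1, so \<open>D n\<close> is eventually equal to \<open>G\<close>, and the uniform bound on
  the level process gives dominated convergence.\<close>

lemma level_process_martingale:
  assumes st: "0 \<le> s" "s \<le> t" "t \<le> 1" and A: "A \<in> sets (filt s)"
  shows "(\<integral>\<omega>. indicator A \<omega> * level_process z s \<omega> \<partial>P) = (\<integral>\<omega>. indicator A \<omega> * level_process z t \<omega> \<partial>P)"
proof -
  obtain \<tau> :: "nat \<Rightarrow> (real \<Rightarrow> nat) \<Rightarrow> real" where \<tau>: "\<And>n. stopping_time filt (\<tau> n)"
    "\<And>n \<omega>. 0 \<le> \<tau> n \<omega>" "\<And>n \<omega>. \<tau> n \<omega> \<le> \<tau> (Suc n) \<omega>" "AE \<omega> in P. \<exists>n. 1 \<le> \<tau> n \<omega>"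
    "\<And>n. martingale_on P (\<lambda>t \<omega>. compensated l (min t (\<tau> n \<omega>)) \<omega>)"
    using local_martingale unfolding local_martingale_on_def by blast
  obtain B where B: "\<And>c \<omega>. \<omega> \<in> Omega \<Longrightarrow> 0 \<le> c \<Longrightarrow> c \<le> 1 \<Longrightarrow> \<bar>level_process z c \<omega>\<bar> \<le> B"
    using level_process_bounded[of z] by metis
  have AP: "A \<in> sets P" using filt_sets_P[OF _ A] st by simp
  define D where "D n \<omega> = indicator A \<omega> * (level_process z (min s (\<tau> n \<omega>)) \<omega> - level_process z (min t (\<tau> n \<omega>)) \<omega>)" for n \<omega>
  have D: "D n \<in> borel_measurable P" "integral\<^sup>L P (D n) = 0" for n
    unfolding D_def using stopped_level_process[OF \<tau>(1)[of n] \<tau>(2)[of n] \<tau>(5)[of n] st A, of z] by auto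
  define G where "G \<omega> = indicator A \<omega> * level_process z s \<omega> - indicator A \<omega> * level_process z t \<omega>" for \<omega>
  have Gi: "integrable P G"
    unfolding G_def using st by (intro Bochner_Integration.integrable_diff level_process_expectation(1) AP) auto
  have "(\<lambda>n. integral\<^sup>L P (D n)) \<longlonglongrightarrow> integral\<^sup>L P G"
  proof (rule integral_dominated_convergence[where w="\<lambda>_. 2 * B"])
    show "G \<in> borel_measurable P" using Gi by simp
    show "integrable P (\<lambda>_. 2 * B)" by simp
    show "D n \<in> borel_measurable P" for n by (rule D)
    show "AE \<omega> in P. (\<lambda>n. D n \<omega>) \<longlonglongrightarrow> G \<omega>"
      using \<tau>(4)
    proof eventually_elim
      case (elim \<omega>)
      then obtain n where n: "1 \<le> \<tau> n \<omega>" by blast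
      have "D m \<omega> = G \<omega>" if "m \<ge> n" for m
      proof -
        have "\<tau> n \<omega> \<le> \<tau> m \<omega>" using that by (rule lift_Suc_mono_le[of "\<lambda>n. \<tau> n \<omega>", OF \<tau>(3)])
        then have "min s (\<tau> m \<omega>) = s" "min t (\<tau> m \<omega>) = t" using n st by auto
        then show ?thesis by (simp add: D_def G_def right_diff_distrib)
      qed
      then show ?case by (intro tendsto_eventually eventually_sequentiallyI)
    qed
    show "AE \<omega> in P. norm (D n \<omega>) \<le> 2 * B" for n
    proof (rule AE_I2)
      fix \<omega> assume "\<omega> \<in> space P"
      then have "\<bar>level_process z (min s (\<tau> n \<omega>)) \<omega>\<bar> \<le> B" "\<bar>level_process z (min t (\<tau> n \<omega>)) \<omega>\<bar> \<le> B"
        using st \<tau>(2)[of n \<omega>] by (auto intro!: B)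
      \<comment> \<open>The second conjunct serves the paths outside \<open>A\<close>, where
        \<open>D n\<close> is 0.\<close>
      moreover have "\<bar>x - y\<bar> \<le> 2 * B \<and> 0 \<le> B" if "\<bar>x\<bar> \<le> B" "\<bar>y\<bar> \<le> B" for x y :: real
        using that by linarith
      ultimately show "norm (D n \<omega>) \<le> 2 * B"
        unfolding D_def by (cases "\<omega> \<in> A") simp_all
    qed
  qed
  then have "integral\<^sup>L P G = 0" unfolding D(2) by (simp add: LIMSEQ_const_iff)
  then show ?thesis
    unfolding G_def using st AP by (subst (asm) Bochner_Integration.integral_diff) (auto intro: level_process_expectation(1))
qed

text \<open>Equal expectations of the level process at \<open>s\<close> and \<open>t\<close> leave
  only the compensator accumulated in between.\<close>

lemma forward_integral_equation:
  assumes st: "0 \<le> s" "s \<le> t" "t \<le> 1" and A: "A \<in> sets (filt s)"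
  shows "prob {\<omega>\<in>A. \<omega> t \<le> z} = prob {\<omega>\<in>A. \<omega> s \<le> z} - integral {s..t} (\<lambda>r. l r z * prob {\<omega>\<in>A. \<omega> r = z})"
proof -
  have AP: "A \<in> sets P" using filt_sets_P[OF _ A] st by simp
  show ?thesis
    using level_process_martingale[OF st A, of z]
      level_process_expectation(2)[OF AP, of s z] level_process_expectation(2)[OF AP, of t z]
      integral_from_0_diff[OF occupation_fubini(2)[OF AP, of 1 z] st] st by simp
qed

text \<open>A bootstrap: the integral equation makes the distribution function \<open>F\<close>
  continuous, hence also its differences \<open>p\<close> and the integrand. The fundamental theorem
  of calculus then differentiates \<open>F\<close>, and differences of consecutive levels give the
  equation for \<open>p\<close>.\<close>

lemma forward_equation:
  assumes su: "0 \<le> s" "u \<le> 1" and A: "A \<in> sets (filt s)" and t: "t \<in> {s..u}"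
  shows "((\<lambda>t. prob {\<omega>\<in>A. \<omega> t = z}) has_real_derivative
     (if z = 0 then 0 else l t (z - 1) * prob {\<omega>\<in>A. \<omega> t = z - 1}) - l t z * prob {\<omega>\<in>A. \<omega> t = z}) (at t within {s..u})"
proof -
  define F where "F z t = prob {\<omega>\<in>A. \<omega> t \<le> z}" for z t
  define p where "p z t = prob {\<omega>\<in>A. \<omega> t = z}" for z t
  have AP: "A \<in> sets P" using filt_sets_P[OF _ A] su t by simp
  have io: "(\<lambda>r. l r z * p z r) integrable_on {s..u}" for z
    unfolding p_def using integrable_subinterval_real[OF occupation_fubini(2)[OF AP, of 1 z], of s u] su by auto
  have F: "F z t = F z s - integral {s..t} (\<lambda>r. l r z * p z r)" if "t \<in> {s..u}" for z t
    unfolding F_def p_def using that su by (intro forward_integral_equation A) auto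
  have pF: "p z t = F z t - (if z = 0 then 0 else F (z - 1) t)" if "t \<in> {s..u}" for z t
  proof (cases z)
    case (Suc k)
    have "{\<omega>\<in>A. \<omega> t = z} = {\<omega>\<in>A. \<omega> t \<le> z} - {\<omega>\<in>A. \<omega> t \<le> k}" using Suc by auto
    then have "p z t = F z t - F k t"
      unfolding p_def F_def using le_sets_P[OF AP, of t] that su Suc
      by (auto intro!: finite_measure_Diff)
    then show ?thesis using Suc by simp
  qed (simp add: p_def F_def)
  have contF: "continuous_on {s..u} (F z)" for z
  proof -
    have "continuous_on {s..u} (\<lambda>t. F z s - integral {s..t} (\<lambda>r. l r z * p z r))"
      by (intro continuous_intros indefinite_integral_continuous_1 io)
    then show ?thesis by (rule continuous_on_eq) (rule F[symmetric])
  qed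
  have contp: "continuous_on {s..u} (p z)" for z
  proof -
    have "continuous_on {s..u} (\<lambda>t. F z t - (if z = 0 then 0 else F (z - 1) t))"
      by (cases "z = 0") (auto intro!: continuous_intros contF)
    then show ?thesis by (rule continuous_on_eq) (rule pF[symmetric])
  qed
  have derF: "(F z has_real_derivative - (l t z * p z t)) (at t within {s..u})" for z
  proof -
    have "continuous_on {s..u} (\<lambda>r. l r z * p z r)"
      using su by (intro continuous_on_mult contp continuous_on_subset[OF cont]) auto
    from integral_has_real_derivative[OF this t]
    have "((\<lambda>t. F z s - integral {s..t} (\<lambda>r. l r z * p z r)) has_real_derivative 0 - l t z * p z t) (at t within {s..u})"
      by (intro DERIV_diff DERIV_const)
    from has_field_derivative_transform_on[OF t F this] show ?thesis by simp
  qed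
  have "((\<lambda>t. F z t - (if z = 0 then 0 else F (z - 1) t)) has_real_derivative
     (if z = 0 then 0 else l t (z - 1) * p (z - 1) t) - l t z * p z t) (at t within {s..u})"
    using DERIV_diff[OF derF[of z] derF[of "z - 1"]] derF[of z] by (cases "z = 0") auto
  from has_field_derivative_transform_on[OF t pF this] show ?thesis
    unfolding p_def .
qed

end

subsection \<open>Convexity criterion and the backward equation\<close>

text \<open>Derivatives are one-sided at the endpoints, so \<open>f'\<close> is shown monotone from
  interior derivatives and continuity. The mean value theorem on both sides of an intermediate point
  \<open>w\<close> then compares the two slopes.\<close>

lemma convex_on_closed_interval_second_derivative:
  fixes f :: "real \<Rightarrow> real"
  assumes f: "\<And>t. t \<in> {s..u} \<Longrightarrow> (f has_real_derivative f' t) (at t within {s..u})"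
    and f': "\<And>t. t \<in> {s..u} \<Longrightarrow> (f' has_real_derivative f'' t) (at t within {s..u})"
    and nonneg: "\<And>t. t \<in> {s..u} \<Longrightarrow> 0 \<le> f'' t"
  shows "convex_on {s..u} f"
proof (rule convex_on_linorderI)
  have cf': "continuous_on {s..u} f'"
    by (rule DERIV_continuous_on[OF f'])
  have mono: "f' a \<le> f' b" if "s \<le> a" "a \<le> b" "b \<le> u" for a b
  proof (rule DERIV_nonneg_imp_increasing_open[OF that(2)])
    fix x assume "a < x" "x < b"
    then show "\<exists>y. DERIV f' x :> y \<and> 0 \<le> y"
      using f'[of x] nonneg[of x] that by (auto simp: at_within_Icc_at)
  qed (rule continuous_on_subset[OF cf'], use that in auto)
  have mvt: "\<exists>c. a < c \<and> c < b \<and> f b - f a = (b - a) * f' c" if "s \<le> a" "a < b" "b \<le> u" for a b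
  proof -
    have "\<exists>c\<in>{a<..<b}. f b - f a = f' c * (b - a)"
    proof (rule mvt_simple[OF that(2)])
      fix x assume "a \<le> x" "x \<le> b"
      then have "(f has_real_derivative f' x) (at x within {a..b})"
        by (intro DERIV_subset[OF f]) (use that in auto)
      then show "(f has_derivative (\<lambda>h. f' x * h)) (at x within {a..b})"
        by (simp add: has_field_derivative_def)
    qed
    then show ?thesis by (auto simp: mult.commute)
  qed
  fix t x y :: real
  assume t: "0 < t" "t < 1" and xy: "x \<in> {s..u}" "y \<in> {s..u}" "x < y"
  define w where "w = (1 - t) * x + t * y"
  have wx: "w - x = t * (y - x)" and yw: "y - w = (1 - t) * (y - x)"
    by (simp_all add: w_def algebra_simps)
  have "0 < w - x" "0 < y - w" unfolding wx yw using t xy by simp_all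
  then have w: "x < w" "w < y" by simp_all
  obtain c where c: "x < c" "c < w" "f w - f x = (w - x) * f' c"
    using mvt[of x w] xy w by auto
  obtain d where d: "w < d" "d < y" "f y - f w = (y - w) * f' d"
    using mvt[of w y] xy w by auto
  have "f' c \<le> f' d" using mono[of c d] c d xy by auto
  then have "t * (1 - t) * (y - x) * f' c \<le> t * (1 - t) * (y - x) * f' d"
    using t xy by (intro mult_left_mono) auto
  moreover have "(1 - t) * (f w - f x) = t * (1 - t) * (y - x) * f' c"
    unfolding c(3) wx by simp
  moreover have "t * (f y - f w) = t * (1 - t) * (y - x) * f' d"
    unfolding d(3) yw by simp
  ultimately have "(1 - t) * (f w - f x) \<le> t * (f y - f w)" by (simp only:)
  moreover have "(1 - t) *\<^sub>R x + t *\<^sub>R y = w" by (simp add: w_def)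
  ultimately show "f ((1 - t) *\<^sub>R x + t *\<^sub>R y) \<le> (1 - t) * f x + t * f y"
    by (simp only: left_diff_distrib right_diff_distrib mult_1_left)
qed simp

text \<open>Variation of constants, integrated backwards from the terminal time \<open>u\<close>.
  The explicit formula shows the sign of the solution as well.\<close>

lemma backward_linear_ode:
  fixes a b :: "real \<Rightarrow> real"
  assumes a: "continuous_on {0..u} a" and b: "continuous_on {0..u} b"
    and nonneg: "\<And>t. t \<in> {0..u} \<Longrightarrow> 0 \<le> b t" "0 \<le> c"
  shows "\<exists>h. (\<forall>t\<in>{0..u}. 0 \<le> h t \<and> (h has_real_derivative a t * h t - b t) (at t within {0..u})) \<and> h u = c"
proof -
  define \<Lambda> where "\<Lambda> t = integral {0..t} a" for t
  have \<Lambda>: "(\<Lambda> has_real_derivative a t) (at t within {0..u})" if "t \<in> {0..u}" for t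
    unfolding \<Lambda>_def by (rule integral_has_real_derivative[OF a that])
  have cont: "continuous_on {0..u} (\<lambda>r. exp (- \<Lambda> r) * b r)"
    by (intro continuous_intros b DERIV_continuous_on[OF \<Lambda>])
  define h where "h t = exp (\<Lambda> t) * (c * exp (- \<Lambda> u) + integral {t..u} (\<lambda>r. exp (- \<Lambda> r) * b r))" for t
  have "(h has_real_derivative a t * h t - b t) (at t within {0..u})" if t: "t \<in> {0..u}" for t
  proof -
    have "(h has_real_derivative exp (\<Lambda> t) * a t * (c * exp (- \<Lambda> u) + integral {t..u} (\<lambda>r. exp (- \<Lambda> r) * b r))
        + (0 + - (exp (- \<Lambda> t) * b t)) * exp (\<Lambda> t)) (at t within {0..u})"
      unfolding h_def
      by (intro DERIV_mult DERIV_add DERIV_const integral_has_real_derivative'[OF cont t]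
          DERIV_chain2[OF DERIV_exp \<Lambda>[OF t]])
    moreover have "exp (- \<Lambda> t) * exp (\<Lambda> t) = 1" by (simp add: exp_minus_inverse mult.commute)
    then have "exp (\<Lambda> t) * a t * (c * exp (- \<Lambda> u) + integral {t..u} (\<lambda>r. exp (- \<Lambda> r) * b r))
        + (0 + - (exp (- \<Lambda> t) * b t)) * exp (\<Lambda> t) = a t * h t - b t"
      by (simp add: h_def mult_ac)
    ultimately show ?thesis by simp
  qed
  moreover have "0 \<le> h t" if t: "t \<in> {0..u}" for t
  proof -
    have "0 \<le> integral {t..u} (\<lambda>r. exp (- \<Lambda> r) * b r)"
      by (intro integral_nonneg integrable_continuous_real continuous_on_subset[OF cont])
         (use t nonneg in auto)
    then show ?thesis using nonneg(2) by (simp add: h_def)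
  qed
  moreover have "h u = c" by (simp add: h_def exp_minus_inverse mult.left_commute)
  ultimately show ?thesis by blast
qed

context intensity
begin

text \<open>The equation at level \<open>z\<close> involves only \<open>z\<close> and
  \<open>Suc z\<close>, and the solution is 0 above \<open>y\<close>. The system is therefore
  triangular and is solved one level at a time downwards from \<open>y\<close>. The value
  \<open>h z t\<close> plays the role of the transition probability from \<open>z\<close> at time
  \<open>t\<close> to \<open>y\<close> at time \<open>u\<close>.\<close>

lemma backward_equation:
  assumes u: "0 \<le> u" "u \<le> 1"
  obtains h :: "nat \<Rightarrow> real \<Rightarrow> real" where
    "\<And>z t. t \<in> {0..u} \<Longrightarrow> 0 \<le> h z t"
    "\<And>z t. t \<in> {0..u} \<Longrightarrow> (h z has_real_derivative - (l t z * (h (Suc z) t - h z t))) (at t within {0..u})"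
    "\<And>z. h z u = (if z = y then 1 else 0)"
    "\<And>z t. y < z \<Longrightarrow> h z t = 0"
proof -
  have c: "continuous_on {0..u} (\<lambda>r. l r z)" for z
    by (rule continuous_on_subset[OF cont]) (use u in auto)
  \<comment> \<open>Here \<open>k\<close> counts how many levels below \<open>y\<close> have been
    solved; lower levels are left unconstrained.\<close>
  define Q where "Q k h \<longleftrightarrow> (\<forall>z\<ge>y - k. \<forall>t\<in>{0..u}. 0 \<le> h z t \<and>
        (h z has_real_derivative - (l t z * (h (Suc z) t - h z t))) (at t within {0..u})) \<and>
      (\<forall>z\<ge>y - k. h z u = (if z = y then 1 else 0)) \<and> (\<forall>z t. y < z \<longrightarrow> h z t = 0)" for k h
  have "\<exists>h. Q k h" if "k \<le> y" for k
    using that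
  proof (induction k)
    case 0
    obtain g where g: "\<forall>t\<in>{0..u}. 0 \<le> g t \<and> (g has_real_derivative l t y * g t - 0) (at t within {0..u})" "g u = 1"
      using backward_linear_ode[OF c[of y], of "\<lambda>_. 0" 1] by auto
    \<comment> \<open>With nothing above \<open>y\<close>, the equation at level \<open>y\<close> is
      homogeneous, with terminal value 1.\<close>
    show ?case
      by (rule exI[of _ "\<lambda>z. if z = y then g else (\<lambda>_. 0)"]) (use g in \<open>auto simp: Q_def\<close>)
  next
    case (Suc k)
    then obtain h where "Q k h" by auto
    then have h: "\<And>z t. z \<ge> y - k \<Longrightarrow> t \<in> {0..u} \<Longrightarrow> 0 \<le> h z t"
      "\<And>z t. z \<ge> y - k \<Longrightarrow> t \<in> {0..u} \<Longrightarrow> (h z has_real_derivative - (l t z * (h (Suc z) t - h z t))) (at t within {0..u})"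
      "\<And>z. z \<ge> y - k \<Longrightarrow> h z u = (if z = y then 1 else 0)" "\<And>z t. y < z \<Longrightarrow> h z t = 0"
      unfolding Q_def by blast+
    define x where "x = y - Suc k"
    have x: "Suc x = y - k" using Suc.prems by (simp add: x_def)
    have "continuous_on {0..u} (\<lambda>r. l r x * h (Suc x) r)"
      by (intro continuous_on_mult c DERIV_continuous_on[OF h(2)]) (simp_all add: x)
    then obtain g where "\<forall>t\<in>{0..u}. 0 \<le> g t \<and>
        (g has_real_derivative l t x * g t - l t x * h (Suc x) t) (at t within {0..u})" "g u = 0"
      using backward_linear_ode[OF c[of x], of "\<lambda>r. l r x * h (Suc x) r" 0] h(1)[of "Suc x"] nonneg[of _ x] x u by auto
    then have g: "\<And>t. t \<in> {0..u} \<Longrightarrow> 0 \<le> g t"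
      "\<And>t. t \<in> {0..u} \<Longrightarrow> (g has_real_derivative l t x * g t - l t x * h (Suc x) t) (at t within {0..u})" "g u = 0"
      by blast+
    show ?case
      unfolding Q_def
    proof (rule exI[of _ "h(x := g)"], intro conjI allI impI ballI)
      fix z t assume z: "z \<ge> y - Suc k" and t: "t \<in> {0..u}"
      \<comment> \<open>The update at \<open>x\<close> does not disturb the higher levels, whose
        equations refer only to themselves and the level above.\<close>
      have "z = x \<or> z \<ge> y - k" using z by (auto simp: x_def)
      moreover have "x < y - k" using x by simp
      ultimately show "0 \<le> (h(x := g)) z t"
        "((h(x := g)) z has_real_derivative - (l t z * ((h(x := g)) (Suc z) t - (h(x := g)) z t))) (at t within {0..u})"
        using h(1)[of z t] h(2)[of z t] g(1,2)[OF t] t by (auto simp: right_diff_distrib)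
    next
      fix z assume z: "z \<ge> y - Suc k"
      have "z = x \<or> z \<ge> y - k" using z by (auto simp: x_def)
      then show "(h(x := g)) z u = (if z = y then 1 else 0)"
        using h(3)[of z] g(3) x by auto
    next
      fix z t assume "y < z"
      then show "(h(x := g)) z t = 0" using h(4)[of z t] by (auto simp: x_def)
    qed
  qed
  from this[of y] obtain h where "Q y h" by auto
  then show ?thesis by (intro that[of h]) (auto simp: Q_def)
qed

end

subsection \<open>Bridges\<close>

text \<open>The forward operator is the transpose of the generator. Truncation at \<open>y\<close>
  leaves one boundary term, which disappears when \<open>G\<close> vanishes at level
  \<open>Suc y\<close>.\<close>

lemma summation_by_parts_shift:
  fixes p c G :: "nat \<Rightarrow> real"
  shows "(\<Sum>z\<le>y. ((if z = 0 then 0 else c (z - 1) * p (z - 1)) - c z * p z) * G z)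
    = (\<Sum>z\<le>y. p z * (c z * (G (Suc z) - G z))) - c y * p y * G (Suc y)"
  by (induction y) (simp_all add: algebra_simps)

context counting_process
begin

text \<open>A truncated Dynkin formula on the event \<open>A\<close>: the derivative consists of the
  time derivative of \<open>G\<close> plus the generator applied to \<open>G\<close>. It is used for
  \<open>h\<close>, for \<open>z\<close> times \<open>h\<close>, and for the intensity times the
  shifted \<open>h\<close>.\<close>

lemma forward_pairing:
  assumes su: "0 \<le> s" "u \<le> 1" and A: "A \<in> sets (filt s)" and t: "t \<in> {s..u}"
    and G: "\<And>z. z \<le> y \<Longrightarrow> (G z has_real_derivative G' z) (at t within {s..u})" and G0: "G (Suc y) t = 0"
  shows "((\<lambda>t. \<Sum>z\<le>y. prob {\<omega>\<in>A. \<omega> t = z} * G z t) has_real_derivative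
      (\<Sum>z\<le>y. prob {\<omega>\<in>A. \<omega> t = z} * (G' z + l t z * (G (Suc z) t - G z t)))) (at t within {s..u})"
proof -
  define p where "p z t = prob {\<omega>\<in>A. \<omega> t = z}" for z t
  define p' where "p' z = (if z = 0 then 0 else l t (z - 1) * p (z - 1) t) - l t z * p z t" for z
  have p: "(p z has_real_derivative p' z) (at t within {s..u})" for z
    unfolding p_def p'_def by (rule forward_equation[OF su A t])
  have "((\<lambda>t. \<Sum>z\<le>y. p z t * G z t) has_real_derivative (\<Sum>z\<le>y. p' z * G z t + G' z * p z t)) (at t within {s..u})"
    using p G by (intro DERIV_sum DERIV_mult) auto
  moreover have "(\<Sum>z\<le>y. p' z * G z t + G' z * p z t) = (\<Sum>z\<le>y. p z t * (G' z + l t z * (G (Suc z) t - G z t)))"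
    using summation_by_parts_shift[of "l t" "\<lambda>z. p z t" "\<lambda>z. G z t" y] G0
    by (simp add: p'_def sum.distrib distrib_left mult.commute)
  ultimately show ?thesis by (simp add: p_def)
qed

text \<open>For \<open>G = h\<close> the time derivative cancels the generator, so the pairing is
  constant on \<open>{t..u}\<close>; at \<open>u\<close> the terminal values select level
  \<open>y\<close>. Allowing every event of the past of \<open>t\<close> makes this the Markov
  property.\<close>

lemma markov_property:
  assumes tu: "0 \<le> t" "t \<le> u" "u \<le> 1" and A: "A \<in> sets (filt t)"
    and h: "\<And>z r. r \<in> {0..u} \<Longrightarrow> (h z has_real_derivative - (l r z * (h (Suc z) r - h z r))) (at r within {0..u})"
      "\<And>z. h z u = (if z = y then 1 else 0)" "\<And>r. h (Suc y) r = 0"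
  shows "prob {\<omega>\<in>A. \<omega> u = y} = (\<Sum>z\<le>y. prob {\<omega>\<in>A. \<omega> t = z} * h z t)"
proof -
  let ?S = "\<lambda>r. \<Sum>z\<le>y. prob {\<omega>\<in>A. \<omega> r = z} * h z r"
  have "\<exists>c. \<forall>r\<in>{t..u}. ?S r = c"
  proof (rule has_field_derivative_zero_constant)
    fix r assume r: "r \<in> {t..u}"
    have "(?S has_real_derivative
      (\<Sum>z\<le>y. prob {\<omega>\<in>A. \<omega> r = z} * (- (l r z * (h (Suc z) r - h z r)) + l r z * (h (Suc z) r - h z r)))) (at r within {t..u})"
      by (intro forward_pairing[OF tu(1,3) A r] DERIV_subset[OF h(1)]) (use r tu h(3) in auto)
    then show "(?S has_real_derivative 0) (at r within {t..u})" by simp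
  qed simp
  then have "?S t = ?S u" using tu by auto
  also have "?S u = (\<Sum>z\<le>y. if z = y then prob {\<omega>\<in>A. \<omega> u = y} else 0)"
    by (intro sum.cong) (auto simp: h(2))
  finally show ?thesis by simp
qed

text \<open>On the conditioning event monotonicity gives \<open>\<omega> t \<le> y\<close>, so the
  expectation is a finite sum. A null conditioning event is covered: both sides are then 0.\<close>

lemma bridge_exp_eq:
  assumes st: "0 \<le> s" "s \<le> t" "t \<le> u" "u \<le> 1"
  shows "bridge_exp P s u x y t = (\<Sum>z\<le>y. real z * prob {\<omega>\<in>Omega. \<omega> s = x \<and> \<omega> t = z \<and> \<omega> u = y})
    / prob {\<omega>\<in>Omega. \<omega> s = x \<and> \<omega> u = y}"
proof -
  define E where "E = {\<omega>\<in>Omega. \<omega> s = x \<and> \<omega> u = y}"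
  have "E = {\<omega>\<in>{\<omega>\<in>space P. \<omega> s = x}. \<omega> u = y}" by (auto simp: E_def)
  then have E: "E \<in> sets P" using st by (simp only:) (intro eq_sets_P sets.top; simp)
  have Ez: "{\<omega>\<in>E. \<omega> t = z} \<in> sets P" for z using st by (intro eq_sets_P E) auto
  have m: "(\<lambda>\<omega>. real (\<omega> t)) \<in> borel_measurable P"
    using measurable_compose[OF measurable_P_eval, of t real borel] st by simp
  have mE: "(indicator E :: _ \<Rightarrow> real) \<in> borel_measurable P" using E by simp
  have dens: "bridge P s u x y = density P (\<lambda>\<omega>. ennreal (indicator E \<omega> / prob E))"
  proof -
    have "AE \<omega> in P. indicator E \<omega> / emeasure P E = ennreal (indicator E \<omega> / prob E)"
    proof (cases "prob E = 0")
      \<comment> \<open>Off the null set \<open>E\<close> both densities vanish; on the left this is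
        because 0 divided by 0 is 0 in \<open>ennreal\<close>.\<close>
      case True
      then have "AE \<omega> in P. \<omega> \<notin> E" using E by (simp add: AE_iff_measurable emeasure_eq_measure prob_eq_0)
      then show ?thesis by eventually_elim simp
    next
      case False
      then have "0 < prob E" by (simp add: zero_less_measure_iff)
      then show ?thesis
        by (intro AE_I2) (simp add: emeasure_eq_measure indicator_def divide_ennreal flip: ennreal_1)
    qed
    then show ?thesis
      unfolding bridge_def uniform_measure_def E_def[symmetric] space_P
      by (intro density_cong) (use E in measurable)
  qed
  have "bridge_exp P s u x y t = (\<integral>\<omega>. (indicator E \<omega> / prob E) *\<^sub>R real (\<omega> t) \<partial>P)"
    unfolding bridge_exp_def dens using m mE by (intro integral_density) auto
  also have "\<dots> = (\<integral>\<omega>. (indicator E \<omega> * real (\<omega> t)) / prob E \<partial>P)"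
    by simp
  also have "\<dots> = (\<integral>\<omega>. indicator E \<omega> * real (\<omega> t) \<partial>P) / prob E"
    by (rule integral_divide_zero)
  also have "(\<integral>\<omega>. indicator E \<omega> * real (\<omega> t) \<partial>P) = (\<integral>\<omega>. (\<Sum>z\<le>y. real z * indicator {\<omega>\<in>E. \<omega> t = z} \<omega>) \<partial>P)"
  proof (rule Bochner_Integration.integral_cong[OF refl])
    fix \<omega> assume "\<omega> \<in> space P"
    then have \<omega>: "\<omega> \<in> Omega" by simp
    show "indicator E \<omega> * real (\<omega> t) = (\<Sum>z\<le>y. real z * indicator {\<omega>\<in>E. \<omega> t = z} \<omega>)"
    proof (cases "\<omega> \<in> E")
      case True
      then have "\<omega> t \<le> y" using path_mono[OF \<omega>, of t u] st by (auto simp: E_def)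
      have "(\<Sum>z\<le>y. real z * indicator {\<omega>\<in>E. \<omega> t = z} \<omega>) = (\<Sum>z\<le>y. if z = \<omega> t then real z else 0)"
        using True by (intro sum.cong) auto
      with True \<open>\<omega> t \<le> y\<close> show ?thesis by simp
    qed simp
  qed
  also have "\<dots> = (\<Sum>z\<le>y. \<integral>\<omega>. real z * indicator {\<omega>\<in>E. \<omega> t = z} \<omega> \<partial>P)"
    using Ez by (intro Bochner_Integration.integral_sum integrable_mult_right integrable_real_indicator)
      (auto simp: emeasure_eq_measure)
  also have "\<dots> = (\<Sum>z\<le>y. real z * prob {\<omega>\<in>E. \<omega> t = z})"
    using Ez sets.sets_into_space[OF Ez] by (simp add: Int_absorb2)
  also have "\<dots> = (\<Sum>z\<le>y. real z * prob {\<omega>\<in>Omega. \<omega> s = x \<and> \<omega> t = z \<and> \<omega> u = y})"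
    by (intro sum.cong arg_cong2[where f="(*)"] arg_cong[where f=prob] refl) (auto simp: E_def)
  finally show ?thesis by (simp only: E_def)
qed

text \<open>The first derivative is the mean jump rate of the bridge, the second a combination of
  the expressions that become the reciprocal characteristic. Of the weights \<open>k\<close> only
  the sign matters for convexity.\<close>

lemma bridge_exp_derivatives:
  assumes su: "0 \<le> s" "s \<le> u" "u \<le> 1"
    and l': "\<And>z t. t \<in> {0..1} \<Longrightarrow> ((\<lambda>r. l r z) has_real_derivative l' z t) (at t within {0..1})"
  obtains f' :: "real \<Rightarrow> real" and k :: "nat \<Rightarrow> real \<Rightarrow> real" where
    "\<And>t. t \<in> {s..u} \<Longrightarrow> (bridge_exp P s u x y has_real_derivative f' t) (at t within {s..u})"
    "\<And>t. t \<in> {s..u} \<Longrightarrow> (f' has_real_derivative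
        (\<Sum>z\<le>y. k z t * (l' z t + l t z * (l t (z + 1) - l t z)))) (at t within {s..u})"
    "\<And>z t. t \<in> {s..u} \<Longrightarrow> 0 \<le> k z t"
proof -
  obtain h :: "nat \<Rightarrow> real \<Rightarrow> real" where h:
    "\<And>z t. t \<in> {0..u} \<Longrightarrow> 0 \<le> h z t"
    "\<And>z t. t \<in> {0..u} \<Longrightarrow> (h z has_real_derivative - (l t z * (h (Suc z) t - h z t))) (at t within {0..u})"
    "\<And>z. h z u = (if z = y then 1 else 0)"
    "\<And>z t. y < z \<Longrightarrow> h z t = 0"
    using backward_equation[of u y] su by auto
  define A where "A = {\<omega>\<in>Omega. \<omega> s = x}"
  define p where "p z t = prob {\<omega>\<in>A. \<omega> t = z}" for z t
  define E where "E = prob {\<omega>\<in>Omega. \<omega> s = x \<and> \<omega> u = y}"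
  have A: "A \<in> sets (filt s)" unfolding A_def using su by (intro filt_eval) auto
  have E0: "0 \<le> E" by (simp add: E_def)
  have formula: "bridge_exp P s u x y t = (\<Sum>z\<le>y. p z t * (real z * h z t)) / E" if t: "t \<in> {s..u}" for t
  proof -
    have "prob {\<omega>\<in>Omega. \<omega> s = x \<and> \<omega> t = z \<and> \<omega> u = y} = p z t * h z t" if "z \<le> y" for z
    proof -
      \<comment> \<open>The event fixes the values at both \<open>s\<close> and \<open>t\<close>, so
        only the term at \<open>z\<close> survives in the Markov sum.\<close>
      define B where "B = {\<omega>\<in>Omega. \<omega> s = x} \<inter> {\<omega>\<in>Omega. \<omega> t = z}"
      have B: "B \<in> sets (filt t)" unfolding B_def using su t by (intro sets.Int filt_eval) auto
      have "{\<omega>\<in>Omega. \<omega> s = x \<and> \<omega> t = z \<and> \<omega> u = y} = {\<omega>\<in>B. \<omega> u = y}"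
        by (auto simp: B_def)
      then have "prob {\<omega>\<in>Omega. \<omega> s = x \<and> \<omega> t = z \<and> \<omega> u = y} = (\<Sum>w\<le>y. prob {\<omega>\<in>B. \<omega> t = w} * h w t)"
        using markov_property[OF _ _ su(3) B h(2,3)] h(4) t su by simp
      also have "\<dots> = (\<Sum>w\<le>y. if w = z then p z t * h z t else 0)"
      proof (rule sum.cong[OF refl])
        fix w
        have "{\<omega>\<in>B. \<omega> t = w} = (if w = z then {\<omega>\<in>A. \<omega> t = z} else {})"
          by (auto simp: B_def A_def)
        then show "prob {\<omega>\<in>B. \<omega> t = w} * h w t = (if w = z then p z t * h z t else 0)"
          by (simp add: p_def)
      qed
      finally show ?thesis using that by simp
    qed
    then show ?thesis
      using bridge_exp_eq[of s t u x y] su t by (simp add: E_def mult_ac)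
  qed
  have hd: "(h z has_real_derivative - (l t z * (h (Suc z) t - h z t))) (at t within {s..u})" if "t \<in> {s..u}" for z t
    by (rule DERIV_subset[OF h(2)]) (use that su in auto)
  have ld: "((\<lambda>r. l r z) has_real_derivative l' z t) (at t within {s..u})" if "t \<in> {s..u}" for z t
    by (rule DERIV_subset[OF l']) (use that su in auto)
  define f' where "f' t = (\<Sum>z\<le>y. p z t * (l t z * h (Suc z) t)) / E" for t
  define k where "k z t = p z t * h (Suc z) t / E" for z t
  have "(bridge_exp P s u x y has_real_derivative f' t) (at t within {s..u})" if t: "t \<in> {s..u}" for t
  proof -
    have "((\<lambda>t. \<Sum>z\<le>y. p z t * (real z * h z t)) has_real_derivative
      (\<Sum>z\<le>y. p z t * (real z * (- (l t z * (h (Suc z) t - h z t))) + l t z * (real (Suc z) * h (Suc z) t - real z * h z t))))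
      (at t within {s..u})"
      unfolding p_def by (intro forward_pairing[OF su(1,3) A t] DERIV_cmult hd[OF t]) (simp add: h(4))
    \<comment> \<open>Since \<open>h\<close> solves the backward equation, only the growth of the
      factor \<open>z\<close> by 1 at a jump contributes.\<close>
    moreover have "real z * (- (l t z * (h (Suc z) t - h z t))) + l t z * (real (Suc z) * h (Suc z) t - real z * h z t)
      = l t z * h (Suc z) t" for z
      by (simp add: algebra_simps)
    ultimately have "((\<lambda>t. \<Sum>z\<le>y. p z t * (real z * h z t)) has_real_derivative
      (\<Sum>z\<le>y. p z t * (l t z * h (Suc z) t))) (at t within {s..u})"
      by (simp only:)
    from has_field_derivative_transform_on[OF t formula DERIV_cdivide[OF this]] show ?thesis
      unfolding f'_def .
  qed
  moreover have "(f' has_real_derivative (\<Sum>z\<le>y. k z t * (l' z t + l t z * (l t (z + 1) - l t z)))) (at t within {s..u})"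
    if t: "t \<in> {s..u}" for t
  proof -
    have "((\<lambda>t. \<Sum>z\<le>y. p z t * (l t z * h (Suc z) t)) has_real_derivative
      (\<Sum>z\<le>y. p z t * ((l' z t * h (Suc z) t + - (l t (Suc z) * (h (Suc (Suc z)) t - h (Suc z) t)) * l t z)
        + l t z * (l t (Suc z) * h (Suc (Suc z)) t - l t z * h (Suc z) t)))) (at t within {s..u})"
      unfolding p_def by (intro forward_pairing[OF su(1,3) A t] DERIV_mult ld[OF t] hd[OF t]) (simp add: h(4))
    \<comment> \<open>The terms with \<open>h (Suc (Suc z))\<close> cancel between the backward
      equation and the generator, so \<open>h (Suc z)\<close> factors out.\<close>
    moreover have "p z t * ((l' z t * h (Suc z) t + - (l t (Suc z) * (h (Suc (Suc z)) t - h (Suc z) t)) * l t z)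
        + l t z * (l t (Suc z) * h (Suc (Suc z)) t - l t z * h (Suc z) t))
      = p z t * h (Suc z) t * (l' z t + l t z * (l t (z + 1) - l t z))" for z
      by (simp add: algebra_simps)
    ultimately have "((\<lambda>t. \<Sum>z\<le>y. p z t * (l t z * h (Suc z) t)) has_real_derivative
      (\<Sum>z\<le>y. p z t * h (Suc z) t * (l' z t + l t z * (l t (z + 1) - l t z)))) (at t within {s..u})"
      by (simp only:)
    from DERIV_cdivide[OF this, of E] show ?thesis
      unfolding f'_def k_def by (simp add: sum_divide_distrib)
  qed
  moreover have "0 \<le> k z t" if "t \<in> {s..u}" for z t
    unfolding k_def p_def using h(1)[of t "Suc z"] that su E0 by simp
  ultimately show ?thesis using that by blast
qed

end

text \<open>The logarithmic derivative times the intensity is the derivative of the intensity.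
  Positivity selects the first branch of \<open>Xi\<close>, and derivatives within
  \<open>{0..1}\<close> are unique even at the endpoints.\<close>

lemma Xi_eq:
  assumes "t \<in> {0..1}" "0 < l t z" "((\<lambda>r. l r z) has_real_derivative l') (at t within {0..1})"
  shows "l' + l t z * (l t (z + 1) - l t z) = l t z * Xi l t z"
proof -
  have "((\<lambda>r. ln (l r z)) has_real_derivative 1 / l t z * l') (at t within {0..1})"
    using assms by (auto intro!: derivative_eq_intros)
  then have "vector_derivative (\<lambda>r. ln (l r z)) (at t within {0..1}) = 1 / l t z * l'"
    using vector_derivative_within_cbox[of 0 1 t] assms(1)
    by (simp add: has_real_derivative_iff_has_vector_derivative)
  then show ?thesis using assms(2) by (simp add: Xi_def field_simps)
qed

theorem theorem2p1:
  fixes l :: "real \<Rightarrow> nat \<Rightarrow> real" and P :: "(real \<Rightarrow> nat) measure"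
  assumes mcp: "markov_counting_process P l"
    and C1: "\<forall>z. \<exists>l'. continuous_on {0..1} l' \<and>
               (\<forall>t\<in>{0..1}. ((\<lambda>r. l r z) has_real_derivative l' t) (at t within {0..1}))"
    and bdd: "\<exists>c. \<forall>t\<in>{0..1}. \<forall>z. \<bar>l t (z + 1) - l t z\<bar> \<le> c"
    and pos: "\<forall>t\<in>{0..1}. \<forall>z. 0 < l t z"
    and init: "\<forall>z. 0 < measure P {\<omega>\<in>space P. \<omega> 0 = z}"
  shows "((\<forall>t\<in>{0..1}. \<forall>z. 0 \<le> Xi l t z) \<longrightarrow>
            (\<forall>s u x y. 0 \<le> s \<and> s \<le> u \<and> u \<le> 1 \<and> x \<le> y \<longrightarrow>
               convex_on {s..u} (bridge_exp P s u x y)))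
       \<and> ((\<forall>t\<in>{0..1}. \<forall>z. Xi l t z \<le> 0) \<longrightarrow>
            (\<forall>s u x y. 0 \<le> s \<and> s \<le> u \<and> u \<le> 1 \<and> x \<le> y \<longrightarrow>
               concave_on {s..u} (bridge_exp P s u x y)))"
proof -
  obtain l' where l': "\<And>z t. t \<in> {0..1} \<Longrightarrow> ((\<lambda>r. l r z) has_real_derivative l' z t) (at t within {0..1})"
    using C1 by metis
  interpret prob_space P using mcp by (simp add: markov_counting_process_def)
  interpret counting_process l P
  proof
    show "continuous_on {0..1} (\<lambda>r. l r z)" for z
      by (rule DERIV_continuous_on[OF l'])
    show "0 \<le> l t z" if "t \<in> {0..1}" for t z
      using pos that by (simp add: less_imp_le)
  qed (use mcp bdd in \<open>auto simp: markov_counting_process_def\<close>)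
  have "((\<forall>t\<in>{0..1}. \<forall>z. 0 \<le> Xi l t z) \<longrightarrow> convex_on {s..u} (bridge_exp P s u x y)) \<and>
    ((\<forall>t\<in>{0..1}. \<forall>z. Xi l t z \<le> 0) \<longrightarrow> concave_on {s..u} (bridge_exp P s u x y))"
    if su: "0 \<le> s" "s \<le> u" "u \<le> 1" for s u x y
  proof -
    obtain f' k where f:
      "\<And>t. t \<in> {s..u} \<Longrightarrow> (bridge_exp P s u x y has_real_derivative f' t) (at t within {s..u})"
      "\<And>t. t \<in> {s..u} \<Longrightarrow> (f' has_real_derivative
          (\<Sum>z\<le>y. k z t * (l' z t + l t z * (l t (z + 1) - l t z)))) (at t within {s..u})"
      "\<And>z t. t \<in> {s..u} \<Longrightarrow> 0 \<le> k z t"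
      using bridge_exp_derivatives[OF su l', of x y] by blast
    \<comment> \<open>Each summand of the second derivative is a nonnegative weight times
      \<open>Xi\<close>, so the sign of \<open>Xi\<close> decides between convexity and
      concavity.\<close>
    have Xi: "k z t * (l' z t + l t z * (l t (z + 1) - l t z)) = (k z t * l t z) * Xi l t z" if "t \<in> {s..u}" for z t
    proof -
      have "t \<in> {0..1}" using that su by auto
      then show ?thesis using Xi_eq[of t l z, OF _ _ l'] pos by simp
    qed
    have w: "0 \<le> k z t * l t z" if "t \<in> {s..u}" for z t
      using f(3)[OF that] nonneg[of t z] that su by simp
    have "convex_on {s..u} (bridge_exp P s u x y)" if "\<forall>t\<in>{0..1}. \<forall>z. 0 \<le> Xi l t z"
    proof (rule convex_on_closed_interval_second_derivative[OF f(1,2)])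
      fix t assume t: "t \<in> {s..u}"
      show "0 \<le> (\<Sum>z\<le>y. k z t * (l' z t + l t z * (l t (z + 1) - l t z)))"
        unfolding Xi[OF t] by (intro sum_nonneg mult_nonneg_nonneg w[OF t]) (use that t su in auto)
    qed
    moreover have "concave_on {s..u} (bridge_exp P s u x y)" if "\<forall>t\<in>{0..1}. \<forall>z. Xi l t z \<le> 0"
      unfolding concave_on_def
    proof (rule convex_on_closed_interval_second_derivative[OF DERIV_minus[OF f(1)] DERIV_minus[OF f(2)]])
      fix t assume t: "t \<in> {s..u}"
      have "(\<Sum>z\<le>y. k z t * (l' z t + l t z * (l t (z + 1) - l t z))) \<le> 0"
        unfolding Xi[OF t] by (intro sum_nonpos mult_nonneg_nonpos w[OF t]) (use that t su in auto)
      then show "0 \<le> - (\<Sum>z\<le>y. k z t * (l' z t + l t z * (l t (z + 1) - l t z)))" by simp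
    qed
    ultimately show ?thesis by blast
  qed
  then show ?thesis by blast
qed

end
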